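(* Let $f$ be an invertible holomorphic function on $\Omega^r$. Then $x\mapsto\log f(x)$ is an affine function on $\mathcal{BT}(\mathbb Q)$: if $\sigma$ is a simplex of $\mathcal{BT}$ with vertices $k_0,\dots,k_n$ and $x=\sum_{0\le i\le n}t_ik_i$ with $(t_0,\dots,t_n)\in\mathbb Q_{\ge0}^{n+1}$, $\sum t_i=1$, then $$\log f(x)=\sum_{0\le i\le n}t_i\log f(k_i).$$
   Context: Let $q$ be a prime power, $K_\infty=\mathbb F_q((T^{-1}))$ with absolute value normalized by $|T|=q$, $C_\infty$ the completion of an algebraic closure of $K_\infty$. Fix $r\ge2$. $\Omega^r$ is the rigid analytic space of points $\omega=(\omega_1:\dots:\omega_r)\in\mathbb P^{r-1}(C_\infty)$ with $\omega_1,\dots,\omega_r$ linearly independent over $K_\infty$. $\mathcal{BT}$ is the Bruhat–Tits building of $\mathrm{PGL}(r,K_\infty)$; its realization is identified with the set of homothety classes of non-archimedean real-valued norms on $K_\infty^r$, and $\mathcal{BT}(\mathbb Q)$ denotes its points with rational barycentric coordinates. The building map $\lambda:\Omega^r\to\mathcal{BT}(\mathbb Q)$ sends $\omega$ to the class of the norm $(x_1,\dots,x_r)\mapsto|\sum_i x_i\omega_i|$. For an invertible holomorphic $f$ on $\Omega^r$, $|f|$ is constant on each fiber $\lambda^{-1}(x)$, and $\log f(x)$ denotes the common value of $\log_q|f(\omega)|$ for $\omega\in\lambda^{-1}(x)$. *)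

theory Defs
  imports "HOL-Analysis.Analysis"
    "HOL-Computational_Algebra.Formal_Laurent_Series"
    "HOL-Algebra.Algebraic_Closure_Type"
begin

section \<open>The fields\<close>

text \<open>
  The finite field with \<open>q\<close> elements is a type \<open>'k\<close> of class \<open>{field, finite}\<close>, so \<open>q = CARD('k)\<close>.
  The type \<open>'k fls\<close> of formal Laurent series is the field of Laurent series in \<open>1/T\<close>: the variable
  \<^const>\<open>fls_X\<close> is the uniformizer \<open>1/T\<close>, and \<open>T\<close> has absolute value \<open>q\<close>.  (The metric that the
  library puts on \<open>'k fls\<close> has a different normalization and is not used.)
\<close>

definition absK :: "'k::{field,finite} fls \<Rightarrow> real" where
  "absK x = (if x = 0 then 0 else real CARD('k) powi (- fls_subdegree x))"

text \<open>
  The completion of the algebraic closure, given by its defining properties: a complete field \<open>'c\<close>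
  whose metric is induced by a multiplicative ultrametric absolute value \<open>absC\<close> (completeness is
  part of the sort of \<open>'c\<close>), together with an embedding \<open>\<iota>\<close> of the algebraic closure with dense
  image such that \<open>absC\<close> extends the normalized absolute value.  (The library restricts
  \<^const>\<open>norm\<close> to real normed spaces, so it is not available here.)
\<close>

definition absC :: "'c::{zero,metric_space} \<Rightarrow> real" where
  "absC x = dist x 0"

locale C_infinity =
  fixes \<iota> :: "'k::{field,finite} fls alg_closure \<Rightarrow> 'c::{field,complete_space}"
  assumes one: "\<iota> 1 = 1"
    and add: "\<iota> (x + y) = \<iota> x + \<iota> y"
    and mult: "\<iota> (x * y) = \<iota> x * \<iota> y"
    and dist_absC: "dist u v = absC (u - v :: 'c)"
    and absC_mult: "absC (u * v :: 'c) = absC u * absC v"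
    and absC_ultrametric: "absC (u + v :: 'c) \<le> max (absC u) (absC v)"
    and absC_extends: "absC (\<iota> (to_ac a)) = absK a"
    and dense: "closure (range \<iota>) = UNIV"

section \<open>The Drinfeld symmetric space\<close>

text \<open>Points of projective space are lines without the origin, \<open>proj_pt w\<close> being \<open>(w\<^sub>1 : \<dots> : w\<^sub>r)\<close>.\<close>

definition proj_pt :: "'c::field^'r \<Rightarrow> ('c^'r) set" where
  "proj_pt w = {c *s w | c. c \<noteq> 0}"

definition lin_form ::
  "('k::{field,finite} fls alg_closure \<Rightarrow> 'c::field) \<Rightarrow> 'k fls^'r::finite \<Rightarrow> 'c^'r \<Rightarrow> 'c" where
  "lin_form \<iota> a w = (\<Sum>j\<in>UNIV. \<iota> (to_ac (a $ j)) * w $ j)"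

definition Omega ::
  "('k::{field,finite} fls alg_closure \<Rightarrow> 'c::field) \<Rightarrow> ('c^'r::finite) set set" where
  "Omega \<iota> = {proj_pt w | w. \<forall>a. lin_form \<iota> a w = 0 \<longrightarrow> a = 0}"

section \<open>Rigid analytic functions\<close>

text \<open>
  \<open>F\<close> is given on \<open>S\<close> by a strictly convergent power series (coefficients tending to 0) in the
  functions \<open>h i\<close>, \<open>i \<in> I\<close>; to be used for finite \<open>I\<close> and functions \<open>h i\<close> bounded by 1 on \<open>S\<close>.
\<close>

definition strictly_convergent ::
  "'p set \<Rightarrow> 'i set \<Rightarrow> ('i \<Rightarrow> 'p \<Rightarrow> 'c::{field,complete_space}) \<Rightarrow> ('p \<Rightarrow> 'c) \<Rightarrow> bool" where
  "strictly_convergent S I h F \<longleftrightarrow>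
     (\<exists>c :: ('i \<Rightarrow> nat) \<Rightarrow> 'c.
        (\<forall>e>0. finite {\<alpha>. (\<forall>i. i \<notin> I \<longrightarrow> \<alpha> i = 0) \<and> absC (c \<alpha>) \<ge> e}) \<and>
        (\<forall>x\<in>S. ((\<lambda>\<alpha>. c \<alpha> * (\<Prod>i\<in>I. h i x ^ \<alpha> i)) has_sum F x) {\<alpha>. \<forall>i. i \<notin> I \<longrightarrow> \<alpha> i = 0}))"

text \<open>
  The affine chart \<open>w\<^sub>l \<noteq> 0\<close> is identified with the vectors normalized by \<open>z $ l = 1\<close>, with
  coordinates \<open>z $ j\<close>, \<open>j \<noteq> l\<close>.  A closed ball of radius \<open>absC \<rho>\<close> in it is a polydisc, with Tate
  algebra the strictly convergent power series in the \<open>z $ j / \<rho>\<close>.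
\<close>

definition chart_ball :: "'r \<Rightarrow> 'c \<Rightarrow> ('c::{field,complete_space}^'r::finite) set" where
  "chart_ball l \<rho> = {z. z $ l = 1 \<and> (\<forall>j. j \<noteq> l \<longrightarrow> absC (z $ j) \<le> absC \<rho>)}"

definition tate_fun ::
  "'r \<Rightarrow> 'c \<Rightarrow> ('c::{field,complete_space}^'r::finite \<Rightarrow> 'c) \<Rightarrow> bool" where
  "tate_fun l \<rho> F \<longleftrightarrow> strictly_convergent (chart_ball l \<rho>) (- {l}) (\<lambda>j z. z $ j / \<rho>) F"

text \<open>
  The data \<open>g, f\<^sub>0, \<dots>, f\<^sub>m\<^sub>-\<^sub>1\<close> (elements of the Tate algebra without common zero) of a rational
  subdomain of a ball, the subdomain \<open>{\<bar>f\<^sub>i\<bar> \<le> \<bar>g\<bar>}\<close> itself, and its affinoid algebra: the strictly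
  convergent power series in the coordinates and in the quotients \<open>f\<^sub>i / g\<close>.  As these spaces are
  reduced, sections of the structure sheaf are identified with functions.
\<close>

definition rational_data ::
  "'r \<Rightarrow> 'c \<Rightarrow> nat \<Rightarrow> ('c::{field,complete_space}^'r::finite \<Rightarrow> 'c)
     \<Rightarrow> (nat \<Rightarrow> 'c^'r \<Rightarrow> 'c) \<Rightarrow> bool" where
  "rational_data l \<rho> m g f \<longleftrightarrow>
     \<rho> \<noteq> 0 \<and> tate_fun l \<rho> g \<and> (\<forall>i<m. tate_fun l \<rho> (f i)) \<and>
     (\<forall>z\<in>chart_ball l \<rho>. g z \<noteq> 0 \<or> (\<exists>i<m. f i z \<noteq> 0))"

definition rational_dom ::
  "'r \<Rightarrow> 'c \<Rightarrow> nat \<Rightarrow> ('c::{field,complete_space}^'r::finite \<Rightarrow> 'c)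
     \<Rightarrow> (nat \<Rightarrow> 'c^'r \<Rightarrow> 'c) \<Rightarrow> ('c^'r) set" where
  "rational_dom l \<rho> m g f = {z \<in> chart_ball l \<rho>. \<forall>i<m. absC (f i z) \<le> absC (g z)}"

definition affinoid_fun ::
  "'r \<Rightarrow> 'c \<Rightarrow> nat \<Rightarrow> ('c::{field,complete_space}^'r::finite \<Rightarrow> 'c)
     \<Rightarrow> (nat \<Rightarrow> 'c^'r \<Rightarrow> 'c) \<Rightarrow> ('c^'r \<Rightarrow> 'c) \<Rightarrow> bool" where
  "affinoid_fun l \<rho> m g f F \<longleftrightarrow>
     strictly_convergent (rational_dom l \<rho> m g f) (Inl ` (- {l}) \<union> Inr ` {..<m})
       (case_sum (\<lambda>j z. z $ j / \<rho>) (\<lambda>i z. f i z / g z)) F"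

text \<open>
  Holomorphic functions on an admissible open subset \<open>U\<close> of projective space: those that restrict
  to an element of the affinoid algebra on every rational subdomain (of a ball in an affine chart)
  contained in \<open>U\<close>.  The set \<^const>\<open>Omega\<close> is admissibly covered by the increasing sequence of such
  domains \<open>\<bar>z $ j\<bar> \<le> q^n\<close>, \<open>\<bar>lin_form \<iota> a z\<bar> \<ge> q^-n\<close> for all \<open>a\<close> with maximum norm 1 (finitely many
  \<open>a\<close> suffice), and every affinoid subdomain contained in it lies in one of them; so for
  \<open>U = Omega \<iota>\<close> these are the global sections of the structure sheaf.
\<close>

definition rigid_holomorphic_on ::
  "('c::{field,complete_space}^'r::finite) set set \<Rightarrow> (('c^'r) set \<Rightarrow> 'c) \<Rightarrow> bool" where
  "rigid_holomorphic_on U F \<longleftrightarrow>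
     (\<forall>l \<rho> m g f. rational_data l \<rho> m g f \<and> proj_pt ` rational_dom l \<rho> m g f \<subseteq> U
        \<longrightarrow> affinoid_fun l \<rho> m g f (\<lambda>z. F (proj_pt z)))"

definition invertible_holomorphic_on ::
  "('c::{field,complete_space}^'r::finite) set set \<Rightarrow> (('c^'r) set \<Rightarrow> 'c) \<Rightarrow> bool" where
  "invertible_holomorphic_on U F \<longleftrightarrow>
     rigid_holomorphic_on U F \<and> (\<exists>G. rigid_holomorphic_on U G \<and> (\<forall>P\<in>U. F P * G P = 1))"

section \<open>The Bruhat--Tits building\<close>

text \<open>
  Points of the realization are homothety classes of norms on the \<open>r\<close>-dimensional space over
  \<open>'k fls\<close>.  A vertex, i.e. the homothety class of a lattice \<open>L\<close>, is the class of the norm with unit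
  ball \<open>L\<close>.
\<close>

definition homothety_class :: "('v \<Rightarrow> real) \<Rightarrow> ('v \<Rightarrow> real) set" where
  "homothety_class N = {\<lambda>v. s * N v | s. s > 0}"

definition is_lattice :: "('k::{field,finite} fls^'r::finite) set \<Rightarrow> bool" where
  "is_lattice L \<longleftrightarrow> (\<exists>A :: 'k fls^'r^'r. invertible A \<and> L = (*v) A ` {x. \<forall>j. absK (x $ j) \<le> 1})"

definition lattice_norm ::
  "('k::{field,finite} fls^'r::finite) set \<Rightarrow> 'k fls^'r \<Rightarrow> real" where
  "lattice_norm L v = Inf {absK a | a. v \<in> (*s) a ` L}"

definition vertex_of :: "('k::{field,finite} fls^'r::finite) set \<Rightarrow> ('k fls^'r \<Rightarrow> real) set" where
  "vertex_of L = homothety_class (lattice_norm L)"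

definition bt_simplex :: "('k::{field,finite} fls^'r::finite \<Rightarrow> real) set set \<Rightarrow> bool" where
  "bt_simplex \<sigma> \<longleftrightarrow>
     (\<exists>n L. (\<forall>i\<le>n. is_lattice (L i)) \<and> (\<forall>i<n. L (Suc i) \<subset> L i) \<and> (*s) fls_X ` L 0 \<subset> L n \<and>
        \<sigma> = (\<lambda>i. vertex_of (L i)) ` {..n::nat})"

text \<open>
  The point \<open>\<Sum>i\<le>n. t i * k i\<close> of a simplex with vertices \<open>k 0, \<dots>, k n\<close>: logarithms of norms are
  combined linearly; the choice of the norms \<open>M i\<close> in the classes \<open>k i\<close> only affects the result by
  a homothety.  This is the usual affine structure: if \<open>L 0 \<supset> \<dots> \<supset> L n \<supset> (1/T) L 0\<close> and the norm of
  \<open>L i\<close> is \<open>v \<mapsto> MAX j. q^(s i j) * \<bar>v\<^sub>j\<bar>\<close> in coordinates \<open>v\<^sub>j\<close> with respect to a common basis (an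
  apartment), then each of \<open>s 0 j \<le> \<dots> \<le> s n j \<le> s 0 j + 1\<close> holds, so for given \<open>v\<close> some \<open>j\<close>
  attains the maximum for all \<open>i\<close> at once, and the combined norm is
  \<open>v \<mapsto> MAX j. q^(\<Sum>i\<le>n. t i * s i j) * \<bar>v\<^sub>j\<bar>\<close>.
\<close>

definition bt_point ::
  "nat \<Rightarrow> (nat \<Rightarrow> rat) \<Rightarrow> (nat \<Rightarrow> ('v \<Rightarrow> real) set) \<Rightarrow> ('v \<Rightarrow> real) set" where
  "bt_point n t k = {\<lambda>v. \<Prod>i\<le>n. M i v powr of_rat (t i) | M. \<forall>i\<le>n. M i \<in> k i}"

text \<open>The class of \<open>a \<mapsto> absC (lin_form \<iota> a w)\<close>, the same for all representatives \<open>w\<close> of \<open>P\<close>.\<close>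

definition building_map ::
  "('k::{field,finite} fls alg_closure \<Rightarrow> 'c::{field,complete_space})
     \<Rightarrow> ('c^'r::finite) set \<Rightarrow> ('k fls^'r \<Rightarrow> real) set" where
  "building_map \<iota> P = (\<Union>w\<in>P. homothety_class (\<lambda>a. absC (lin_form \<iota> a w)))"

text \<open>The common value of \<open>log\<^sub>q \<bar>F\<bar>\<close> on the fiber of the building map over \<open>x\<close>.\<close>

definition log_on_building ::
  "('k::{field,finite} fls alg_closure \<Rightarrow> 'c::{field,complete_space})
     \<Rightarrow> (('c^'r::finite) set \<Rightarrow> 'c) \<Rightarrow> ('k fls^'r \<Rightarrow> real) set \<Rightarrow> real" where
  "log_on_building \<iota> F x =
     (THE y. \<forall>P\<in>Omega \<iota>. building_map \<iota> P = x \<longrightarrow> log (real CARD('k)) (absC (F P)) = y)"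

end

theory Submission
  imports Defs
begin

text \<open>
  On an affinoid neighbourhood of the preimage of a simplex, \<open>f\<close> and \<open>1 / f\<close> are uniform limits of
  rational functions whose denominators are products of linear forms over \<open>'k fls\<close>.  As \<open>f\<close> is bounded
  away from 0 there, its absolute value is that of such a rational function.  On the fibre over a norm the
  absolute value of a linear form is the value of that norm, and its logarithm is affine by definition of
  the barycentric coordinates, so only the numerator matters; it has no zeros.

  A polynomial in one variable without zeros in the open unit discs around 0 and 1 has the same absolute
  value at 0 and 1, since each of its roots has the same distance to both.  Applied to the line joining
  two points \<open>y\<close>, \<open>y'\<close> with the same norm, this shows that \<open>\<bar>f\<bar>\<close> is constant on the
  fibres, because \<open>y + \<tau> (y' - y)\<close> has this norm, too, if \<open>\<bar>\<tau>\<bar> < 1\<close> or \<open>\<bar>\<tau> - 1\<bar> < 1\<close>.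

  If \<open>y\<^sub>0, \<dots>, y\<^sub>n\<close> are sufficiently generic points above the vertices and \<open>\<theta>\<close> is a root of the
  uniformizer, then \<open>\<Sum>i\<le>n. \<theta> ^ d i *s y\<^sub>i\<close> with \<open>d i = s\<^sub>0 + \<dots> + s\<^sub>i\<^sub>-\<^sub>1\<close> lies above the point with
  barycentric coordinates proportional to \<open>s\<close>.  Shifting weight from \<open>s\<^sub>a\<close> to \<open>s\<^sub>b\<close> multiplies the summands
  with \<open>a < i \<le> b\<close> by a common factor, that is, moves along a line, and along a line \<open>log \<bar>f\<bar>\<close> is convex in
  \<open>log \<bar>\<tau>\<bar>\<close>.  The same holds for \<open>1 / f\<close>, so \<open>log f\<close> is affine in the directions of the edges, and
  induction on the number of nonzero weights concludes.
\<close>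

hide_const (open) Polynomials.degree Polynomials.lead_coeff up_ring.coeff up_ring.monom module.smult
no_notation fps_nth (infixl "$" 75)

section \<open>Absolute values\<close>

lemma absK_nonneg: "absK a \<ge> 0"
  by (simp add: absK_def)

lemma absK_0 [simp]: "absK 0 = 0"
  by (simp add: absK_def)

lemma card_field_gt_1: "real CARD('k::{field,finite}) > 1"
proof -
  have "card {0, 1 :: 'k} \<le> CARD('k)"
    by (intro card_mono) auto
  then show ?thesis
    by simp
qed

context C_infinity
begin

text \<open>Unlike \<open>CARD('k)\<close>, this term fixes the type \<open>'k\<close> through the parameter \<open>\<iota>\<close>.\<close>

definition q :: real where "q = absC (\<iota> (to_ac (inverse fls_X)))"

lemma q_eq: "q = real CARD('k)"
  by (simp add: q_def absC_extends absK_def fls_inverse_X)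

lemma q_gt_1: "q > 1"
  unfolding q_eq by (rule card_field_gt_1)

lemma q_pos [simp]: "q > 0" and q_nonneg [simp]: "q \<ge> 0"
  and q_ge_1 [simp]: "q \<ge> 1" and q_neq_1 [simp]: "q \<noteq> 1"
  using q_gt_1 by auto

lemma q_nonzero [simp]: "q \<noteq> 0"
  using q_gt_1 by linarith

lemma absK_eq: "absK (a :: 'k fls) = (if a = 0 then 0 else q powi (- fls_subdegree a))"
  by (simp add: absK_def q_eq)

lemma absC_0 [simp]: "absC (0 :: 'c) = 0"
  by (simp add: absC_def)

lemma absC_nonneg [simp]: "absC (u :: 'c) \<ge> 0"
  by (simp add: absC_def)

lemma absC_eq_0_iff [simp]: "absC (u :: 'c) = 0 \<longleftrightarrow> u = 0"
  by (simp add: absC_def)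

lemma absC_pos_iff [simp]: "absC (u :: 'c) > 0 \<longleftrightarrow> u \<noteq> 0"
  by (simp add: absC_def)

lemma absC_1 [simp]: "absC (1 :: 'c) = 1"
  using absC_mult[of 1 1] absC_eq_0_iff[of 1] by (metis mult.right_neutral mult_cancel_left zero_neq_one)

lemma absC_minus [simp]: "absC (- u :: 'c) = absC u"
proof -
  have "absC (- 1 :: 'c) ^ 2 = 1"
    using absC_mult[of "- 1" "- 1"] by (simp add: power2_eq_square)
  then have "absC (- 1 :: 'c) = 1"
    using absC_nonneg[of "- 1"] by (simp add: power2_eq_1_iff)
  then show ?thesis
    using absC_mult[of "- 1" u] by simp
qed

lemma absC_diff_commute: "absC (u - v :: 'c) = absC (v - u)"
  using absC_minus[of "u - v"] by simp

lemma absC_diff_ultrametric: "absC (u - v :: 'c) \<le> max (absC u) (absC v)"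
  using absC_ultrametric[of u "- v"] by simp

lemma absC_add_eq_left: "absC (v :: 'c) < absC u \<Longrightarrow> absC (u + v) = absC u"
  using absC_ultrametric[of u v] absC_diff_ultrametric[of "u + v" v] by auto

lemma absC_eq_if_close: "absC (u - v :: 'c) < absC v \<Longrightarrow> absC u = absC v"
  using absC_add_eq_left[of "u - v" v] by simp

lemma absC_inverse [simp]: "absC (inverse u :: 'c) = inverse (absC u)"
proof (cases "u = 0")
  case False
  then show ?thesis
    using absC_mult[of "inverse u" u] by (simp add: field_simps)
qed simp

lemma absC_divide: "absC (u / v :: 'c) = absC u / absC v"
  by (simp add: divide_inverse absC_mult)

lemma absC_power: "absC (u ^ n :: 'c) = absC u ^ n"
  by (induction n) (simp_all add: absC_mult)

lemma absC_prod: "absC (\<Prod>i\<in>I. g i :: 'c) = (\<Prod>i\<in>I. absC (g i))"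
  by (induction I rule: infinite_finite_induct) (simp_all add: absC_mult)

lemma absC_sum_le: "(\<And>i. i \<in> I \<Longrightarrow> absC (g i :: 'c) \<le> b) \<Longrightarrow> b \<ge> 0 \<Longrightarrow> absC (\<Sum>i\<in>I. g i) \<le> b"
proof (induction I rule: infinite_finite_induct)
  case (insert i I)
  then have "absC (g i) \<le> b" "absC (\<Sum>i\<in>I. g i) \<le> b"
    by auto
  with insert.hyps show ?case
    using absC_ultrametric[of "g i" "\<Sum>i\<in>I. g i"] by auto
qed auto

lemma absC_sum_less: "(\<And>i. i \<in> I \<Longrightarrow> absC (g i :: 'c) < b) \<Longrightarrow> b > 0 \<Longrightarrow> absC (\<Sum>i\<in>I. g i) < b"
proof (induction I rule: infinite_finite_induct)
  case (insert i I)
  then have "absC (g i) < b" "absC (\<Sum>i\<in>I. g i) < b"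
    by auto
  with insert.hyps show ?case
    using absC_ultrametric[of "g i" "\<Sum>i\<in>I. g i"] by auto
qed auto

lemma iota_0 [simp]: "\<iota> 0 = 0"
proof -
  have "\<iota> 0 + \<iota> 0 = \<iota> 0 + 0"
    unfolding add[symmetric] by (simp only: add_0_right)
  then show ?thesis
    by (rule add_left_imp_eq)
qed

lemma iota_minus: "\<iota> (- x) = - \<iota> x"
  using add[of x "- x"] by (simp add: eq_neg_iff_add_eq_0 add.commute)

lemma iota_diff: "\<iota> (x - y) = \<iota> x - \<iota> y"
  using add[of x "- y"] by (simp add: iota_minus)

lemma iota_sum: "\<iota> (\<Sum>i\<in>I. g i) = (\<Sum>i\<in>I. \<iota> (g i))"
  by (induction I rule: infinite_finite_induct) (simp_all add: add)

lemma iota_prod: "\<iota> (\<Prod>i\<in>I. g i) = (\<Prod>i\<in>I. \<iota> (g i))"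
  by (induction I rule: infinite_finite_induct) (simp_all add: mult one)

lemma iota_power: "\<iota> (x ^ n) = \<iota> x ^ n"
  by (induction n) (simp_all add: mult one)

abbreviation emb :: "'k fls \<Rightarrow> 'c" where "emb a \<equiv> \<iota> (to_ac a)"

lemma emb_1 [simp]: "emb 1 = 1"
  by (simp add: one)

lemma emb_mult: "emb (a * b) = emb a * emb b"
  by (simp add: mult)

lemma emb_diff: "emb (a - b) = emb a - emb b"
  by (simp add: iota_diff)

lemma emb_sum: "emb (\<Sum>i\<in>I. g i) = (\<Sum>i\<in>I. emb (g i))"
  by (simp add: to_ac_sum iota_sum)

lemma emb_power: "emb (a ^ n) = emb a ^ n"
  by (simp add: iota_power)

lemma absK_mult: "absK (a * b :: 'k fls) = absK a * absK b"
  by (metis absC_extends absC_mult emb_mult)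

lemma absK_eq_0_iff [simp]: "absK (a :: 'k fls) = 0 \<longleftrightarrow> a = 0"
  using q_gt_1 by (auto simp: absK_eq power_int_def)

lemma absK_1 [simp]: "absK (1 :: 'k fls) = 1"
  by (metis absC_1 absC_extends emb_1)

lemma absK_inverse: "absK (inverse a :: 'k fls) = inverse (absK a)"
proof (cases "a = 0")
  case False
  then show ?thesis
    using absK_mult[of "inverse a" a] by (simp add: field_simps)
qed simp

lemma absK_divide: "absK (a / b :: 'k fls) = absK a / absK b"
  by (simp add: divide_inverse absK_mult absK_inverse)

lemma emb_eq_0_iff [simp]: "emb a = 0 \<longleftrightarrow> a = 0"
  by (metis absC_extends absK_eq_0_iff absC_eq_0_iff)

lemma absK_fls_X [simp]: "absK (fls_X :: 'k fls) = inverse q"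
  by (simp add: absK_eq power_int_minus)

lemma absK_fls_const: "c \<noteq> 0 \<Longrightarrow> absK (fls_const c :: 'k fls) = 1"
  by (simp add: absK_eq)

lemma fls_const_approx:
  assumes "absK (a :: 'k fls) \<le> 1"
  shows "absK (a - fls_const (fls_nth a 0)) \<le> inverse q"
proof (cases "a - fls_const (fls_nth a 0) = 0")
  case False
  have "fls_subdegree a \<ge> 0"
  proof (rule ccontr)
    assume "\<not> fls_subdegree a \<ge> 0"
    then have "a \<noteq> 0" "q powi (- fls_subdegree a) > 1"
      using q_gt_1 by (auto intro!: one_less_power_int)
    with assms show False
      by (simp add: absK_eq)
  qed
  then have "fls_nth (a - fls_const (fls_nth a 0)) k = 0" if "k < 1" for k
    using that by (cases "k = 0") auto
  with False have "1 \<le> fls_subdegree (a - fls_const (fls_nth a 0))"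
    by (rule fls_subdegree_geI)
  then have "q powi (- fls_subdegree (a - fls_const (fls_nth a 0))) \<le> q powi (- 1)"
    by (intro power_int_increasing) simp_all
  then show ?thesis
    unfolding absK_eq by (simp only: False if_False power_int_minus power_int_1_right)
qed simp

section \<open>Lattice norms and linear forms\<close>

lemma absK_sum_le: "(\<And>i. i \<in> I \<Longrightarrow> absK (g i :: 'k fls) \<le> b) \<Longrightarrow> b \<ge> 0 \<Longrightarrow> absK (\<Sum>i\<in>I. g i) \<le> b"
  using absC_sum_le[of I "\<lambda>i. emb (g i)" b] by (simp only: absC_extends flip: emb_sum)

lemma lattice_norm_props:
  fixes L :: "('k fls^'r::finite) set"
  assumes "is_lattice L"
  shows "\<exists>B C :: 'k fls^'r^'r. B ** C = mat 1 \<and> C ** B = mat 1 \<and>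
    (\<forall>v j. absK ((B *v v) $ j) \<le> lattice_norm L v) \<and> (\<forall>v. \<exists>j. lattice_norm L v = absK ((B *v v) $ j)) \<and>
    (\<forall>v a. v \<in> (*s) a ` L \<longleftrightarrow> lattice_norm L v \<le> absK a)"
proof -
  from assms obtain A :: "'k fls^'r^'r" where A: "invertible A" and L: "L = (*v) A ` {x. \<forall>j. absK (x $ j) \<le> 1}"
    unfolding is_lattice_def by blast
  from A obtain B where AB: "A ** B = mat 1" "B ** A = mat 1"
    unfolding invertible_def by blast
  have BA: "B *v (A *v v) = v" "A *v (B *v v) = v" for v
    by (simp_all add: matrix_vector_mul_assoc AB)
  have smult: "M *v (a *s v) = a *s (M *v v)" for M :: "'k fls^'r^'r" and a v
    by (simp add: vec_eq_iff matrix_vector_mult_def sum_distrib_left mult_ac)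
  have mem: "v \<in> (*s) a ` L \<longleftrightarrow> (\<forall>j. absK ((B *v v) $ j) \<le> absK a)" for v a
  proof
    assume "v \<in> (*s) a ` L"
    then obtain x where x: "v = a *s (A *v x)" "\<And>j. absK (x $ j) \<le> 1"
      unfolding L by blast
    show "\<forall>j. absK ((B *v v) $ j) \<le> absK a"
      unfolding x(1) smult BA using mult_left_le[OF x(2) absK_nonneg[of a]]
      by (simp add: absK_mult)
  next
    assume le: "\<forall>j. absK ((B *v v) $ j) \<le> absK a"
    define x where "x = inverse a *s (B *v v)"
    have "absK (x $ j) \<le> 1" for j
    proof (cases "a = 0")
      case False
      then have "absK a > 0"
        using absK_nonneg[of a] by (simp add: less_le)
      moreover have "absK (x $ j) = absK ((B *v v) $ j) / absK a"
        by (simp only: x_def vector_smult_component absK_mult absK_inverse divide_inverse mult.commute)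
      ultimately show ?thesis
        using le by (simp add: divide_le_eq)
    qed (simp add: x_def)
    moreover have "a *s x = B *v v"
    proof (cases "a = 0")
      case True
      then have "(B *v v) $ j = 0" for j
        using le[rule_format, of j] absK_nonneg[of "(B *v v) $ j"] by simp
      then show ?thesis
        by (simp add: True vec_eq_iff)
    next
      case False
      then show ?thesis
        by (simp add: x_def)
    qed
    then have "v = a *s (A *v x)"
      by (metis BA(2) smult)
    ultimately show "v \<in> (*s) a ` L"
      unfolding L by blast
  qed
  define M where "M = (\<lambda>v. Max (range (\<lambda>j. absK ((B *v v) $ j))))"
  have M_le: "absK ((B *v v) $ j) \<le> M v" for v j
    unfolding M_def by (intro Max_ge) auto
  have M_eq: "\<exists>j. M v = absK ((B *v v) $ j)" for v
  proof -
    have "M v \<in> range (\<lambda>j. absK ((B *v v) $ j))"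
      unfolding M_def by (intro Max_in) auto
    then show ?thesis
      by blast
  qed
  have mem_M: "v \<in> (*s) a ` L \<longleftrightarrow> M v \<le> absK a" for v a
    unfolding mem using M_le[of v] M_eq[of v] by (metis order_trans)
  have "lattice_norm L v = M v" for v
    unfolding lattice_norm_def mem_M using M_eq[of v] by (intro cInf_eq_minimum) auto
  with AB(2,1) M_le M_eq mem_M show ?thesis
    by (intro exI[of _ B] exI[of _ A]) auto
qed

context
  fixes L :: "('k fls^'r::finite) set"
  assumes L: "is_lattice L"
begin

lemma lattice_norm_attained: "\<exists>a :: 'k fls. lattice_norm L v = absK a"
  using lattice_norm_props[OF L] by blast

lemma mem_scaled_lattice: "v \<in> (*s) a ` L \<longleftrightarrow> lattice_norm L v \<le> absK a"
  using lattice_norm_props[OF L] by blast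

lemma lattice_norm_nonneg: "lattice_norm L v \<ge> 0"
  using lattice_norm_attained[of v] absK_nonneg by metis

lemma lattice_norm_lower_bound: "\<exists>\<kappa>>0. \<forall>v j. \<kappa> * absK (v $ j) \<le> lattice_norm L v"
proof -
  obtain B C :: "'k fls^'r^'r" where CB: "C ** B = mat 1" and le: "\<And>v j. absK ((B *v v) $ j) \<le> lattice_norm L v"
    using lattice_norm_props[OF L] by blast
  define c where "c = 1 + (\<Sum>i\<in>UNIV. \<Sum>j\<in>UNIV. absK (C $ i $ j))"
  have "absK (C $ i $ j) \<le> (\<Sum>j\<in>UNIV. absK (C $ i $ j))" for i j
    by (intro member_le_sum) (auto simp: absK_nonneg)
  also have "\<dots> i \<le> (\<Sum>i\<in>UNIV. \<Sum>j\<in>UNIV. absK (C $ i $ j))" for i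
    by (intro member_le_sum) (auto simp: absK_nonneg sum_nonneg)
  finally have C_le: "absK (C $ i $ j) \<le> c" for i j
    by (simp add: c_def add_increasing)
  have "(\<Sum>i\<in>UNIV. \<Sum>j\<in>UNIV. absK (C $ i $ j)) \<ge> 0"
    by (intro sum_nonneg) (simp add: absK_nonneg)
  then have c: "c > 0"
    by (simp add: c_def)
  have "absK (v $ i) \<le> c * lattice_norm L v" for v i
  proof -
    have "v = C *v (B *v v)"
      by (simp add: matrix_vector_mul_assoc CB)
    then have "v $ i = (\<Sum>j\<in>UNIV. C $ i $ j * (B *v v) $ j)"
      by (metis (no_types) matrix_vector_mult_def vec_lambda_beta)
    also have "absK \<dots> \<le> c * lattice_norm L v"
      using c C_le le lattice_norm_nonneg
      by (intro absK_sum_le) (auto simp: absK_mult absK_nonneg intro!: mult_mono)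
    finally show ?thesis .
  qed
  then show ?thesis
    using c by (intro exI[of _ "inverse c"]) (simp add: field_simps)
qed

lemma lattice_norm_eq_0_iff [simp]: "lattice_norm L v = 0 \<longleftrightarrow> v = 0"
proof
  assume v: "lattice_norm L v = 0"
  obtain \<kappa> where \<kappa>: "\<kappa> > 0" "\<And>v j. \<kappa> * absK (v $ j) \<le> lattice_norm L v"
    using lattice_norm_lower_bound by blast
  have "absK (v $ j) = 0" for j
    using \<kappa>(2)[of v j] \<kappa>(1) absK_nonneg[of "v $ j"] by (simp add: v mult_le_0_iff)
  then show "v = 0"
    by (simp add: vec_eq_iff)
next
  assume "v = 0"
  obtain B :: "'k fls^'r^'r" where "\<exists>j. lattice_norm L v = absK ((B *v v) $ j)"
    using lattice_norm_props[OF L] by blast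
  with \<open>v = 0\<close> show "lattice_norm L v = 0"
    by auto
qed

lemma lattice_norm_pos: "v \<noteq> 0 \<Longrightarrow> lattice_norm L v > 0"
  using lattice_norm_nonneg[of v] by (simp add: less_le)

lemma lattice_norm_powi:
  assumes "v \<noteq> 0"
  shows "\<exists>m. lattice_norm L v = q powi m"
proof -
  obtain a :: "'k fls" where a: "lattice_norm L v = absK a"
    using lattice_norm_attained by blast
  then have "a \<noteq> 0"
    using lattice_norm_pos[OF assms] by auto
  then show ?thesis
    unfolding a absK_eq by auto
qed

lemma lattice_norm_antimono:
  assumes "is_lattice L'" "L' \<subseteq> L"
  shows "lattice_norm L v \<le> lattice_norm L' v"
proof -
  obtain a :: "'k fls" where a: "lattice_norm L' v = absK a"
    using C_infinity.lattice_norm_attained[OF C_infinity_axioms assms(1)] by blast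
  then have "v \<in> (*s) a ` L'"
    using C_infinity.mem_scaled_lattice[OF C_infinity_axioms assms(1)] by simp
  then have "v \<in> (*s) a ` L"
    using assms(2) by blast
  then show ?thesis
    using mem_scaled_lattice a by simp
qed

lemma lattice_norm_fls_X:
  assumes "is_lattice L'" "(*s) fls_X ` L \<subseteq> L'"
  shows "lattice_norm L' v \<le> q * lattice_norm L v"
proof -
  obtain a :: "'k fls" where a: "lattice_norm L v = absK a"
    using lattice_norm_attained by blast
  then obtain u where u: "u \<in> L" "v = a *s u"
    using mem_scaled_lattice[of v a] by auto
  have "a / fls_X * fls_X = a"
    using nonzero_eq_divide_eq[OF fls_X_nonzero, of "a / fls_X" a] by blast
  then have "v = (a / fls_X) *s (fls_X *s u)"
    unfolding vector_smult_assoc using u(2) by simp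
  then have "v \<in> (*s) (a / fls_X) ` L'"
    using u assms(2) by blast
  then have "lattice_norm L' v \<le> absK (a / fls_X)"
    using C_infinity.mem_scaled_lattice[OF C_infinity_axioms assms(1)] by blast
  then show ?thesis
    unfolding absK_divide absK_fls_X a by (simp add: field_simps)
qed

end

abbreviation lform :: "'k fls^'r::finite \<Rightarrow> 'c^'r \<Rightarrow> 'c" where "lform \<equiv> lin_form \<iota>"

lemma lform_add: "lform v (x + y) = lform v x + lform v y"
  by (simp add: lin_form_def distrib_left sum.distrib)

lemma lform_scale: "lform v (c *s y) = c * lform v y"
  by (simp add: lin_form_def sum_distrib_left mult_ac)

lemma lform_0 [simp]: "lform v 0 = 0" "lform 0 y = 0"
  by (simp_all add: lin_form_def)

lemma lform_sum: "lform v (\<Sum>i\<in>I. g i) = (\<Sum>i\<in>I. lform v (g i))"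
  by (induction I rule: infinite_finite_induct) (simp_all add: lform_add)

lemma lform_scale_left: "lform (a *s v) y = emb a * lform v y"
  by (simp add: lin_form_def sum_distrib_left mult mult_ac)

lemma lform_diff_left: "lform (u - v) y = lform u y - lform v y"
  by (simp add: lin_form_def iota_diff left_diff_distrib sum_subtractf)

lemma lform_axis: "lform (axis j 1) y = y $ j"
proof -
  have "lform (axis j 1) y = (\<Sum>i\<in>UNIV. if i = j then y $ i else 0)"
    unfolding lin_form_def by (intro sum.cong) (auto simp: axis_def one)
  then show ?thesis
    by simp
qed

lemma absC_lform_le:
  fixes v :: "'k fls^'r::finite" and y :: "'c^'r"
  assumes "\<And>j. absK (v $ j) \<le> a" "\<And>j. absC (y $ j) \<le> b" "a \<ge> 0" "b \<ge> 0"
  shows "absC (lform v y) \<le> a * b"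
  unfolding lin_form_def using assms
  by (intro absC_sum_le) (auto simp: absC_mult absC_extends absK_nonneg intro!: mult_mono)

lemma lform_matrix: "lform v (\<chi> k. \<Sum>j\<in>UNIV. emb (B $ j $ k) * \<eta> j) = (\<Sum>j\<in>UNIV. emb ((B *v v) $ j) * \<eta> j)"
proof -
  have "lform v (\<chi> k. \<Sum>j\<in>UNIV. emb (B $ j $ k) * \<eta> j) =
      (\<Sum>k\<in>UNIV. \<Sum>j\<in>UNIV. emb (B $ j $ k) * emb (v $ k) * \<eta> j)"
    by (simp add: lin_form_def sum_distrib_left mult_ac)
  also have "\<dots> = (\<Sum>j\<in>UNIV. \<Sum>k\<in>UNIV. emb (B $ j $ k) * emb (v $ k) * \<eta> j)"
    by (rule sum.swap)
  also have "\<dots> = (\<Sum>j\<in>UNIV. emb ((B *v v) $ j) * \<eta> j)"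
    by (simp add: matrix_vector_mult_def to_ac_sum iota_sum mult sum_distrib_right)
  finally show ?thesis .
qed

lemma mem_OmegaI: "(\<And>v. lform v y = 0 \<Longrightarrow> v = 0) \<Longrightarrow> proj_pt y \<in> Omega \<iota>"
  unfolding Omega_def by blast

lemma proj_pt_scale:
  fixes y :: "'c^'r::finite"
  assumes "c \<noteq> 0"
  shows "proj_pt (c *s y) = proj_pt y"
proof
  show "proj_pt (c *s y) \<subseteq> proj_pt y"
    using assms by (auto simp: proj_pt_def vector_smult_assoc)
  show "proj_pt y \<subseteq> proj_pt (c *s y)"
  proof
    fix x assume "x \<in> proj_pt y"
    then obtain d where "d \<noteq> 0" "x = d *s y"
      by (auto simp: proj_pt_def)
    then have "x = (d / c) *s (c *s y)" "d / c \<noteq> 0"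
      using assms by (simp_all add: vector_smult_assoc)
    then show "x \<in> proj_pt (c *s y)"
      unfolding proj_pt_def by blast
  qed
qed

section \<open>Residually independent elements\<close>

abbreviation const_emb :: "'k \<Rightarrow> 'c" where "const_emb c \<equiv> emb (fls_const c)"

lemma absC_const_emb: "absC (const_emb c) = (if c = 0 then 0 else 1)"
  by (simp add: absC_extends absK_fls_const)

text \<open>
  If \<open>\<zeta>\<close> is a root of \<open>H - 1\<close>, where \<open>H\<close> is the product of all nonzero polynomials over the finite
  field of degree less than \<open>m\<close>, then all of these polynomials are units at \<open>\<zeta>\<close>.
\<close>

lemma ex_residually_independent_powers:
  obtains \<zeta> :: 'c where "absC \<zeta> \<le> 1"
    "\<And>c :: nat \<Rightarrow> 'k. (\<exists>i<m. c i \<noteq> 0) \<Longrightarrow> absC (\<Sum>i<m. const_emb (c i) * \<zeta> ^ i) = 1"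
proof (cases "m \<ge> 2")
  case False
  have "absC (\<Sum>i<m. const_emb (c i) * 0 ^ i) = 1" if "\<exists>i<m. c i \<noteq> 0" for c :: "nat \<Rightarrow> 'k"
  proof -
    have "m = 1"
      using that False by (cases m) auto
    then show ?thesis
      using that by (simp add: absC_const_emb)
  qed
  then show ?thesis
    using that[of 0] by simp
next
  case m: True
  define Cs where "Cs = {c \<in> {..<m} \<rightarrow>\<^sub>E (UNIV :: 'k set). \<exists>i<m. c i \<noteq> 0}"
  have fin: "finite Cs"
    unfolding Cs_def by (intro finite_subset[OF _ finite_PiE[of "{..<m}" "\<lambda>_. UNIV"]]) auto
  define P where "P = (\<lambda>c :: nat \<Rightarrow> 'k. \<Sum>i<m. monom (to_ac (fls_const (c i))) i)"
  have coeff_P: "coeff (P c) i = (if i < m then to_ac (fls_const (c i)) else 0)" for c i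
    by (auto simp: P_def coeff_sum)
  define c1 where "c1 = restrict (\<lambda>i. if i = 1 then 1 else 0 :: 'k) {..<m}"
  have c1: "c1 \<in> Cs"
    using m by (auto simp: Cs_def c1_def intro!: exI[of _ 1])
  have P_nz: "P c \<noteq> 0" if "c \<in> Cs" for c
  proof -
    obtain i where "i < m" "c i \<noteq> 0"
      using \<open>c \<in> Cs\<close> by (auto simp: Cs_def)
    then have "coeff (P c) i \<noteq> 0"
      by (simp add: coeff_P)
    then show ?thesis
      by auto
  qed
  define H where "H = (\<Prod>c\<in>Cs. P c)"
  have "coeff (P c1) 1 \<noteq> 0"
    using m by (simp add: coeff_P c1_def)
  then have "1 \<le> degree (P c1)"
    by (rule le_degree)
  also have "\<dots> \<le> (\<Sum>c\<in>Cs. degree (P c))"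
    using fin c1 by (intro member_le_sum) auto
  also have "\<dots> = degree H"
    using P_nz by (simp add: H_def degree_prod_eq_sum_degree)
  finally have deg_H: "degree H \<ge> 1" .
  then have "degree (H + (- 1)) = degree H"
    by (intro degree_add_eq_left) simp
  with deg_H have "degree (H - 1) > 0"
    by simp
  then obtain x where "poly (H - 1) x = 0"
    using alg_closed_imp_poly_has_root by blast
  then have H_x: "poly H x = 1"
    by simp
  define \<zeta> where "\<zeta> = \<iota> x"
  define ev where "ev = (\<lambda>c. \<Sum>i<m. const_emb (c i) * \<zeta> ^ i)"
  have ev: "\<iota> (poly (P c) x) = ev c" for c
    by (simp add: P_def poly_sum poly_monom iota_sum mult iota_power \<zeta>_def ev_def)
  have "(\<Prod>c\<in>Cs. ev c) = \<iota> (poly H x)"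
    by (simp add: H_def poly_prod iota_prod ev)
  then have prod_1: "(\<Prod>c\<in>Cs. absC (ev c)) = 1"
    by (metis H_x absC_1 absC_prod one)
  have \<zeta>_le: "absC \<zeta> \<le> 1"
  proof (rule ccontr)
    assume "\<not> absC \<zeta> \<le> 1"
    then have gt: "absC \<zeta> > 1"
      by simp
    then have pos: "absC \<zeta> ^ i > 0" for i
      using less_trans[OF zero_less_one gt] by (rule_tac zero_less_power)
    have "absC (ev c) \<ge> 1" if c: "c \<in> Cs" for c
    proof -
      define d where "d = Max {i. i < m \<and> c i \<noteq> 0}"
      have d: "d < m" "c d \<noteq> 0"
        using Max_in[of "{i. i < m \<and> c i \<noteq> 0}"] c by (auto simp: d_def Cs_def)
      have above: "c i = 0" if "i < m" "i > d" for i
      proof (rule ccontr)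
        assume "c i \<noteq> 0"
        with that have "i \<le> d"
          unfolding d_def by (intro Max_ge) auto
        with that show False
          by simp
      qed
      have "absC (const_emb (c i) * \<zeta> ^ i) < absC \<zeta> ^ d" if "i \<in> {..<m} - {d}" for i
      proof (cases "i < d")
        case True
        then have "absC \<zeta> ^ i < absC \<zeta> ^ d"
          using gt by (intro power_strict_increasing)
        then show ?thesis
          using pos by (simp add: absC_mult absC_power absC_const_emb)
      next
        case False
        then show ?thesis
          using above[of i] that pos by (cases "c i = 0") (auto simp: absC_mult)
      qed
      then have "absC (\<Sum>i\<in>{..<m} - {d}. const_emb (c i) * \<zeta> ^ i) < absC \<zeta> ^ d"
        using pos by (intro absC_sum_less) auto
      moreover have "absC (const_emb (c d) * \<zeta> ^ d) = absC \<zeta> ^ d"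
        using d by (simp add: absC_mult absC_power absC_const_emb)
      moreover have "ev c = const_emb (c d) * \<zeta> ^ d + (\<Sum>i\<in>{..<m} - {d}. const_emb (c i) * \<zeta> ^ i)"
        unfolding ev_def using d by (intro sum.remove) auto
      ultimately have "absC (ev c) = absC \<zeta> ^ d"
        by (metis absC_add_eq_left)
      then show ?thesis
        using gt by simp
    qed
    then have "1 \<le> (\<Prod>c\<in>Cs - {c1}. absC (ev c))"
      by (intro prod_ge_1) auto
    then have "absC \<zeta> * 1 \<le> absC \<zeta> * (\<Prod>c\<in>Cs - {c1}. absC (ev c))"
      by (intro mult_left_mono) auto
    moreover have "ev c1 = \<zeta>"
    proof -
      have "ev c1 = (\<Sum>i\<in>{1}. const_emb (c1 i) * \<zeta> ^ i)"
        unfolding ev_def using m by (intro sum.mono_neutral_right) (auto simp: c1_def)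
      then show ?thesis
        using m by (simp add: c1_def one)
    qed
    ultimately have "(\<Prod>c\<in>Cs. absC (ev c)) > 1"
      using prod.remove[OF fin c1, of "\<lambda>c. absC (ev c)"] gt by simp
    with prod_1 show False
      by simp
  qed
  have le_1: "absC (ev c) \<le> 1" for c
    unfolding ev_def using \<zeta>_le
    by (intro absC_sum_le) (auto simp: absC_mult absC_power absC_const_emb power_le_one)
  have "absC (ev c) = 1" if "\<exists>i<m. c i \<noteq> 0" for c
  proof -
    define c' where "c' = restrict c {..<m}"
    have c': "c' \<in> Cs"
      using that by (auto simp: Cs_def c'_def)
    have "(\<Prod>c\<in>Cs - {c'}. absC (ev c)) \<le> 1"
      using le_1 by (intro prod_le_1) auto
    then have "absC (ev c') \<ge> absC (ev c') * (\<Prod>c\<in>Cs - {c'}. absC (ev c))"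
      by (simp add: mult_left_le)
    then have "absC (ev c') \<ge> 1"
      using prod.remove[OF fin c', of "\<lambda>c. absC (ev c)"] prod_1 by simp
    moreover have "ev c' = ev c"
      unfolding ev_def by (intro sum.cong) (auto simp: c'_def)
    ultimately show ?thesis
      using le_1[of c] by simp
  qed
  then show ?thesis
    using that[OF \<zeta>_le] by (simp add: ev_def)
qed

definition residually_independent :: "'i set \<Rightarrow> ('i \<Rightarrow> 'c) \<Rightarrow> bool" where
  "residually_independent I \<eta> \<longleftrightarrow>
     (\<forall>i\<in>I. absC (\<eta> i) \<le> 1) \<and> (\<forall>c. (\<exists>i\<in>I. c i \<noteq> 0) \<longrightarrow> absC (\<Sum>i\<in>I. const_emb (c i) * \<eta> i) = 1)"

lemma ex_residually_independent:
  assumes "finite I"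
  shows "\<exists>\<eta>. residually_independent I \<eta>"
proof -
  obtain h where h: "bij_betw h I {..<card I}"
    using assms finite_same_card_bij[of I "{..<card I}"] by auto
  obtain \<zeta> :: 'c where \<zeta>: "absC \<zeta> \<le> 1"
    "\<And>c :: nat \<Rightarrow> 'k. (\<exists>i<card I. c i \<noteq> 0) \<Longrightarrow> absC (\<Sum>i<card I. const_emb (c i) * \<zeta> ^ i) = 1"
    using ex_residually_independent_powers by metis
  have "absC (\<Sum>i\<in>I. const_emb (c i) * \<zeta> ^ h i) = 1" if "\<exists>i\<in>I. c i \<noteq> 0" for c
  proof -
    have inv: "inv_into I h (h i) = i" if "i \<in> I" for i
      using that h by (simp add: bij_betw_def)
    have "(\<Sum>i\<in>I. const_emb (c i) * \<zeta> ^ h i) = (\<Sum>i\<in>I. const_emb (c (inv_into I h (h i))) * \<zeta> ^ h i)"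
      using inv by (intro sum.cong) auto
    also have "\<dots> = (\<Sum>j<card I. const_emb (c (inv_into I h j)) * \<zeta> ^ j)"
      by (rule sum.reindex_bij_betw[OF h])
    also have "absC \<dots> = 1"
    proof (rule \<zeta>(2))
      from that obtain i where "i \<in> I" "c i \<noteq> 0"
        by blast
      then show "\<exists>j<card I. c (inv_into I h j) \<noteq> 0"
        using inv bij_betwE[OF h] by (intro exI[of _ "h i"]) auto
    qed
    finally show ?thesis .
  qed
  then show ?thesis
    using \<zeta>(1) by (intro exI[of _ "\<lambda>i. \<zeta> ^ h i"])
      (auto simp: residually_independent_def absC_power power_le_one)
qed

lemma ramified_residue:
  assumes D: "D > 0" "\<theta> ^ D = emb fls_X" and le: "absC (\<theta> powi k * emb a) \<le> 1"
  obtains c where "absC (\<theta> powi k * emb a - const_emb c) < 1"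
proof (cases "absC (\<theta> powi k * emb a) < 1")
  case True
  then show ?thesis
    using that[of 0] by simp
next
  case False
  with le have eq_1: "absC (\<theta> powi k * emb a) = 1"
    by simp
  then have a: "a \<noteq> 0"
    by auto
  have \<theta>: "absC \<theta> ^ D = inverse q"
    using D(2) by (metis absC_extends absC_power absK_fls_X)
  then have \<theta>_nz: "\<theta> \<noteq> 0"
    using D(1) by (metis absC_0 inverse_nonzero_iff_nonzero less_irrefl power_0_left q_pos)
  have pow: "absC (x powi j) = absC x powi j" for x :: 'c and j
    by (auto simp: power_int_def absC_power power_inverse)
  have "q powi k = q powi (int D * - fls_subdegree a)"
  proof -
    have "1 = (absC (\<theta> powi k * emb a)) ^ D"
      by (simp add: eq_1)
    also have "\<dots> = (absC \<theta> powi k) ^ D * absK a ^ D"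
      by (simp add: absC_mult absC_extends pow power_mult_distrib)
    also have "(absC \<theta> powi k) ^ D = inverse q powi k"
      unfolding \<theta>[symmetric] by (simp add: power_int_power power_int_power' mult.commute)
    also have "absK a ^ D = q powi (int D * - fls_subdegree a)"
      using a by (simp add: absK_eq power_int_power' mult.commute)
    finally show ?thesis
      by (simp add: field_simps power_int_inverse)
  qed
  then have k: "k = - (int D * fls_subdegree a)"
    using power_int_strict_increasing[OF _ q_gt_1, of k "- (int D * fls_subdegree a)"]
      power_int_strict_increasing[OF _ q_gt_1, of "- (int D * fls_subdegree a)" k]
    by (cases k "- (int D * fls_subdegree a)" rule: linorder_cases) auto
  define b where "b = fls_X powi (- fls_subdegree a) * a"
  have "\<theta> powi k = (\<theta> ^ D) powi (- fls_subdegree a)"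
    unfolding k by (simp add: power_int_power)
  also have "\<dots> = emb (fls_X powi (- fls_subdegree a))"
  proof -
    have "emb (x powi j) = emb x powi j" for x j
    proof -
      have "emb (inverse x) = inverse (emb x)"
        by (metis emb_1 emb_mult emb_eq_0_iff inverse_unique inverse_zero right_inverse)
      then show ?thesis
        by (simp add: power_int_def emb_power del: to_ac_power to_ac_inverse)
    qed
    then show ?thesis
      by (simp only: D(2))
  qed
  finally have b: "\<theta> powi k * emb a = emb b"
    by (simp only: b_def emb_mult)
  then have "absK b \<le> 1"
    using le by (simp add: absC_extends)
  then have "absC (emb b - const_emb (fls_nth b 0)) \<le> inverse q"
    unfolding emb_diff[symmetric] absC_extends by (rule fls_const_approx)
  also have "\<dots> < 1"
    using q_gt_1 by (simp add: inverse_less_1_iff)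
  finally have "absC (emb b - const_emb (fls_nth b 0)) < 1" .
  then show ?thesis
    using that b by metis
qed

text \<open>
  Adjoining \<open>\<theta>\<close> does not enlarge the residue field, so elements that are independent over it stay
  orthogonal.
\<close>

lemma absC_sum_residually_independent:
  fixes a :: "'i \<Rightarrow> 'k fls" and e :: "'i \<Rightarrow> nat"
  assumes D: "D > 0" "\<theta> ^ D = emb fls_X" and I: "finite I" "I \<noteq> {}" and \<eta>: "residually_independent I \<eta>"
  defines "S \<equiv> (\<Sum>i\<in>I. \<theta> ^ e i * emb (a i) * \<eta> i)"
  shows "\<exists>i\<in>I. absC S = absC (\<theta> ^ e i * emb (a i))"
    and "i \<in> I \<Longrightarrow> absC (\<theta> ^ e i * emb (a i)) \<le> absC S"
proof -
  define g where "g = (\<lambda>i. absC (\<theta> ^ e i * emb (a i)))"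
  have "Max (g ` I) \<in> g ` I"
    using I by (intro Max_in) auto
  then obtain i0 where i0: "i0 \<in> I" "g i0 = Max (g ` I)"
    by auto
  have max: "g j \<le> g i0" if "j \<in> I" for j
    using that I i0 by simp
  have "absC S = g i0"
  proof (cases "g i0 = 0")
    case True
    then have "\<theta> ^ e i * emb (a i) = 0" if "i \<in> I" for i
      using max[OF that] by (simp only: g_def) (metis absC_eq_0_iff absC_nonneg order_antisym)
    then have "S = 0"
      unfolding S_def by (intro sum.neutral) simp
    then show ?thesis
      using True by simp
  next
    case False
    define w where "w = \<theta> ^ e i0 * emb (a i0)"
    have w: "w \<noteq> 0" "g i0 = absC w"
      using False by (auto simp: w_def g_def)
    define u where "u = (\<lambda>i. \<theta> ^ e i * emb (a i) / w)"
    have nz: "\<theta> \<noteq> 0" "a i0 \<noteq> 0"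
      using w(1) D by (auto simp: w_def power_0_left)
    have "u i = \<theta> powi (int (e i) - int (e i0)) * emb (a i / a i0)" for i
    proof -
      have "emb (a i) = emb (a i / a i0) * emb (a i0)"
        using nz by (simp flip: emb_mult del: to_ac_divide to_ac_mult)
      then show ?thesis
        using nz by (simp add: u_def w_def power_int_diff del: to_ac_divide)
    qed
    moreover have u_le: "absC (u i) \<le> 1" if "i \<in> I" for i
      using max[OF that] w by (simp add: u_def absC_divide g_def divide_le_eq)
    ultimately have "\<exists>c. absC (u i - const_emb c) < 1" if "i \<in> I" for i
      using ramified_residue[OF D] that by metis
    then obtain c where c: "\<And>i. i \<in> I \<Longrightarrow> absC (u i - const_emb (c i)) < 1"
      by metis
    have "c i0 \<noteq> 0"
      using c[OF i0(1)] w by (auto simp: u_def w_def)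
    then have "absC (\<Sum>i\<in>I. const_emb (c i) * \<eta> i) = 1"
      using \<eta> i0 by (auto simp: residually_independent_def)
    moreover have "absC (\<Sum>i\<in>I. (u i - const_emb (c i)) * \<eta> i) < 1"
    proof (rule absC_sum_less)
      fix i assume i: "i \<in> I"
      have "absC (u i - const_emb (c i)) * absC (\<eta> i) \<le> absC (u i - const_emb (c i))"
        using \<eta> i by (intro mult_left_le) (auto simp: residually_independent_def)
      then show "absC ((u i - const_emb (c i)) * \<eta> i) < 1"
        using c[OF i] by (simp add: absC_mult)
    qed simp
    moreover have "S / w = (\<Sum>i\<in>I. const_emb (c i) * \<eta> i) + (\<Sum>i\<in>I. (u i - const_emb (c i)) * \<eta> i)"
      by (simp add: S_def u_def sum_divide_distrib algebra_simps flip: sum.distrib)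
    ultimately have "absC (S / w) = 1"
      using absC_add_eq_left by metis
    then show ?thesis
      using w by (simp add: absC_divide)
  qed
  then show "\<exists>i\<in>I. absC S = absC (\<theta> ^ e i * emb (a i))"
    and "i \<in> I \<Longrightarrow> absC (\<theta> ^ e i * emb (a i)) \<le> absC S"
    using i0(1) max unfolding g_def by (blast, simp only:)
qed

section \<open>Absolute values of polynomials in one variable\<close>

lemma map_poly_iota_mult: "map_poly \<iota> (p * r) = map_poly \<iota> p * map_poly \<iota> r"
  by (rule poly_eqI) (simp add: coeff_map_poly coeff_mult iota_sum mult)

lemma poly_map_iota_prod_mset:
  "poly (map_poly \<iota> (\<Prod>x\<in>#Z. [:- x, 1:])) z = (\<Prod>x\<in>#image_mset \<iota> Z. z - x)"
proof (induction Z)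
  case (add x Z)
  have "map_poly \<iota> [:- x, 1:] = [:- \<iota> x, 1:]"
    by (simp add: map_poly_pCons iota_minus one)
  then have "poly (map_poly \<iota> [:- x, 1:]) z = z - \<iota> x"
    by simp
  with add show ?case
    by (simp add: map_poly_iota_mult del: mult_pCons_left)
qed (simp add: one map_poly_1)

lemma dense_iota: "e > 0 \<Longrightarrow> \<exists>x. absC (u - \<iota> x) < e"
proof -
  assume "e > 0"
  have "u \<in> closure (range \<iota>)"
    by (simp add: dense)
  with \<open>e > 0\<close> obtain x where "dist (\<iota> x) u < e"
    unfolding closure_approachable by blast
  then show ?thesis
    by (metis dist_absC dist_commute)
qed

text \<open>Only the algebraic closure, not its completion, is known to split polynomials.\<close>

lemma poly_approx_split:
  fixes p :: "'c poly"
  assumes "\<delta> > 0"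
  obtains a Z where "\<And>z. absC z \<le> R \<Longrightarrow> absC (poly p z - a * (\<Prod>x\<in>#Z. z - x)) < \<delta>"
proof -
  define R' where "R' = max 1 R"
  define \<delta>' where "\<delta>' = \<delta> / R' ^ degree p"
  have R': "R' \<ge> 1" "R' \<ge> R"
    by (auto simp: R'_def)
  then have "\<delta>' > 0"
    using assms by (simp add: \<delta>'_def)
  then have "\<forall>k. \<exists>x. absC (coeff p k - \<iota> x) < \<delta>'"
    using dense_iota by blast
  then obtain g where g: "\<And>k. absC (coeff p k - \<iota> (g k)) < \<delta>'"
    by metis
  define P where "P = (\<Sum>k\<le>degree p. monom (g k) k)"
  obtain Z where Z: "P = smult (lead_coeff P) (\<Prod>x\<in>#Z. [:- x, 1:])"
  proof (cases "P = 0")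
    case True
    then show ?thesis
      using that[of "{#}"] by simp
  next
    case False
    then show ?thesis
      using alg_closed_imp_factorization[of P] that by blast
  qed
  have coeff_P: "coeff P k = (if k \<le> degree p then g k else 0)" for k
    by (auto simp: P_def coeff_sum)
  have *: "poly (map_poly \<iota> P) z = (\<Sum>k\<le>degree p. \<iota> (g k) * z ^ k)" for z
  proof -
    have "map_poly \<iota> P = (\<Sum>k\<le>degree p. monom (\<iota> (g k)) k)"
      by (rule poly_eqI) (simp add: coeff_map_poly coeff_P coeff_sum)
    then show ?thesis
      by (simp only: poly_sum poly_monom)
  qed
  have "map_poly \<iota> P = map_poly \<iota> [:lead_coeff P:] * map_poly \<iota> (\<Prod>x\<in>#Z. [:- x, 1:])"
    by (subst Z, subst map_poly_iota_mult[symmetric]) simp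
  then have split: "poly (map_poly \<iota> P) z = \<iota> (lead_coeff P) * (\<Prod>x\<in>#image_mset \<iota> Z. z - x)" for z
    by (simp only: poly_mult poly_map_iota_prod_mset) (simp add: map_poly_pCons)
  have "absC (poly p z - \<iota> (lead_coeff P) * (\<Prod>x\<in>#image_mset \<iota> Z. z - x)) < \<delta>" if "absC z \<le> R" for z
  proof -
    have "absC ((coeff p k - \<iota> (g k)) * z ^ k) < \<delta>" if "k \<le> degree p" for k
    proof -
      have "absC z ^ k \<le> R' ^ k"
        using \<open>absC z \<le> R\<close> R' by (intro power_mono) auto
      also have "\<dots> \<le> R' ^ degree p"
        using R' that by (intro power_increasing) auto
      finally have "absC (coeff p k - \<iota> (g k)) * absC z ^ k \<le> absC (coeff p k - \<iota> (g k)) * R' ^ degree p"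
        by (intro mult_left_mono) auto
      also have "\<dots> < \<delta>' * R' ^ degree p"
        using g[of k] R' by (intro mult_strict_right_mono) auto
      finally have "absC (coeff p k - \<iota> (g k)) * absC z ^ k < \<delta>' * R' ^ degree p" .
      then show ?thesis
        using R' by (simp add: absC_mult absC_power \<delta>'_def)
    qed
    then have "absC (\<Sum>k\<le>degree p. (coeff p k - \<iota> (g k)) * z ^ k) < \<delta>"
      using assms by (intro absC_sum_less) auto
    moreover have "poly p z - poly (map_poly \<iota> P) z = (\<Sum>k\<le>degree p. (coeff p k - \<iota> (g k)) * z ^ k)"
      by (simp add: * poly_altdef[of p] sum_subtractf left_diff_distrib)
    ultimately show ?thesis
      by (simp add: split)
  qed
  then show ?thesis
    using that by blast
qed

lemma absC_prod_mset: "absC (\<Prod>x\<in>#Z. g x :: 'c) = (\<Prod>x\<in>#Z. absC (g x))"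
  by (induction Z) (simp_all add: absC_mult)

lemma absC_poly_0_eq_1:
  fixes p :: "'c poly"
  assumes "\<delta> > 0" and lower: "\<And>x. absC x < 1 \<or> absC (x - 1) < 1 \<Longrightarrow> absC (poly p x) \<ge> \<delta>"
  shows "absC (poly p 0) = absC (poly p 1)"
proof -
  obtain a Z where approx: "\<And>z. absC z \<le> 1 \<Longrightarrow> absC (poly p z - a * (\<Prod>x\<in>#Z. z - x)) < \<delta>"
    using poly_approx_split[OF \<open>\<delta> > 0\<close>, of 1 p] by metis
  have roots: "absC x \<ge> 1 \<and> absC (x - 1) \<ge> 1" if "x \<in># Z" for x
  proof (rule ccontr)
    assume "\<not> (absC x \<ge> 1 \<and> absC (x - 1) \<ge> 1)"
    then have *: "absC x < 1 \<or> absC (x - 1) < 1"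
      by auto
    then have "absC x \<le> 1"
      using absC_ultrametric[of "x - 1" 1] by auto
    moreover have prod_0: "(\<Prod>y\<in>#Z. x - y) = 0"
      using that by auto
    ultimately show False
      using approx[of x, unfolded prod_0] lower[OF *] by simp
  qed
  have "absC (0 - x) = absC (1 - x)" if "x \<in># Z" for x
  proof (cases "absC x > 1")
    case True
    then show ?thesis
      using absC_add_eq_left[of 1 "- x"] by simp
  next
    case False
    then show ?thesis
      using roots[OF that] absC_diff_ultrametric[of x 1] absC_diff_commute[of x 1] by auto
  qed
  then have "image_mset (\<lambda>x. absC (0 - x)) Z = image_mset (\<lambda>x. absC (1 - x)) Z"
    by (rule image_mset_cong)
  then have "absC (a * (\<Prod>x\<in>#Z. 0 - x)) = absC (a * (\<Prod>x\<in>#Z. 1 - x))"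
    by (simp only: absC_mult absC_prod_mset)
  moreover have poly_eq: "absC (poly p z) = absC (a * (\<Prod>x\<in>#Z. z - x))" if "z = 0 \<or> z = 1" for z
  proof -
    have "absC (a * (\<Prod>x\<in>#Z. z - x) - poly p z) < absC (poly p z)"
      using approx[of z] lower[of z] that by (subst absC_diff_commute) force
    then show ?thesis
      using absC_eq_if_close by metis
  qed
  ultimately show ?thesis
    using poly_eq[of 0] poly_eq[of 1] by (simp only: simp_thms)
qed

text \<open>
  Each root \<open>x\<close> contributes \<open>max (log q (absC \<tau>)) (log q (absC x))\<close> to the logarithm of the
  absolute value at \<open>\<tau>\<close>.
\<close>

lemma log_absC_poly_convex:
  fixes p :: "'c poly"
  assumes "\<delta> > 0"
    and lower: "\<And>\<tau> x. \<tau> \<in> {\<tau>0, \<tau>1, \<tau>2} \<Longrightarrow> absC (x - \<tau>) < absC \<tau> \<Longrightarrow> absC (poly p x) \<ge> \<delta>"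
    and nz: "\<tau>0 \<noteq> 0" "\<tau>1 \<noteq> 0" "\<tau>2 \<noteq> 0" and "x \<ge> 0" "y \<ge> 0"
    and interp: "(x + y) * log q (absC \<tau>1) = x * log q (absC \<tau>0) + y * log q (absC \<tau>2)"
  shows "(x + y) * log q (absC (poly p \<tau>1)) \<le> x * log q (absC (poly p \<tau>0)) + y * log q (absC (poly p \<tau>2))"
proof -
  define R where "R = Max (absC ` {\<tau>0, \<tau>1, \<tau>2})"
  have R: "absC \<tau> \<le> R" if "\<tau> \<in> {\<tau>0, \<tau>1, \<tau>2}" for \<tau>
    using that unfolding R_def by (intro Max_ge) auto
  obtain a Z where approx: "\<And>z. absC z \<le> R \<Longrightarrow> absC (poly p z - a * (\<Prod>x\<in>#Z. z - x)) < \<delta>"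
    using poly_approx_split[OF \<open>\<delta> > 0\<close>, of R p] by metis
  have dist_root: "absC (\<tau> - z) = max (absC \<tau>) (absC z)" if \<tau>: "\<tau> \<in> {\<tau>0, \<tau>1, \<tau>2}" and z: "z \<in># Z" for \<tau> z
  proof (rule ccontr)
    assume neq: "absC (\<tau> - z) \<noteq> max (absC \<tau>) (absC z)"
    then have eq: "absC z = absC \<tau>"
      using absC_add_eq_left[of "- z" \<tau>] absC_add_eq_left[of \<tau> "- z"]
      by (cases "absC z" "absC \<tau>" rule: linorder_cases) auto
    then have "absC (z - \<tau>) < absC \<tau>"
      using neq absC_diff_ultrametric[of \<tau> z] by (auto simp: absC_diff_commute)
    then have "absC (poly p z) \<ge> \<delta>"
      using lower \<tau> by blast
    moreover have prod_0: "(\<Prod>y\<in>#Z. z - y) = 0"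
      using z by auto
    ultimately show False
      using approx[of z, unfolded prod_0] eq R[OF \<tau>] by simp
  qed
  have abs_p: "absC (poly p \<tau>) = absC a * (\<Prod>z\<in>#Z. max (absC \<tau>) (absC z)) \<and> a \<noteq> 0"
    if \<tau>: "\<tau> \<in> {\<tau>0, \<tau>1, \<tau>2}" for \<tau>
  proof -
    have p: "absC (poly p \<tau>) \<ge> \<delta>"
      using lower[OF \<tau>, of \<tau>] \<tau> nz by auto
    then have "absC (a * (\<Prod>z\<in>#Z. \<tau> - z) - poly p \<tau>) < absC (poly p \<tau>)"
      using approx[of \<tau>] R[OF \<tau>] by (subst absC_diff_commute) auto
    then have "absC (poly p \<tau>) = absC (a * (\<Prod>z\<in>#Z. \<tau> - z))"
      using absC_eq_if_close by metis
    also have "\<dots> = absC a * (\<Prod>z\<in>#Z. max (absC \<tau>) (absC z))"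
      using image_mset_cong[of Z "\<lambda>z. absC (\<tau> - z)" "\<lambda>z. max (absC \<tau>) (absC z)"] dist_root[OF \<tau>]
      by (simp only: absC_mult absC_prod_mset)
    finally show ?thesis
      using p \<open>\<delta> > 0\<close> by auto
  qed
  have pos: "(\<Prod>z\<in>#Y. max (absC \<tau>) (absC z)) > 0" if "\<tau> \<in> {\<tau>0, \<tau>1, \<tau>2}" for \<tau> and Y :: "'c multiset"
    using that nz by (induction Y) (auto simp: less_max_iff_disj)
  define \<psi> where "\<psi> = (\<lambda>Y (\<tau> :: 'c). log q (\<Prod>z\<in>#Y. max (absC \<tau>) (absC (z :: 'c))))"
  have "(x + y) * \<psi> Y \<tau>1 \<le> x * \<psi> Y \<tau>0 + y * \<psi> Y \<tau>2" for Y
  proof (induction Y)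
    case (add z Y)
    define l where "l = (\<lambda>\<tau> :: 'c. log q (max (absC \<tau>) (absC z)))"
    have step: "\<psi> (add_mset z Y) \<tau> = l \<tau> + \<psi> Y \<tau>" if "\<tau> \<in> {\<tau>0, \<tau>1, \<tau>2}" for \<tau>
    proof -
      have "max (absC \<tau>) (absC z) > 0"
        using that nz by (auto simp: less_max_iff_disj)
      with pos[OF that, of Y] show ?thesis
        unfolding \<psi>_def l_def image_mset_add_mset prod_mset.add_mset by (intro log_mult_pos)
    qed
    have "(x + y) * l \<tau>1 \<le> x * l \<tau>0 + y * l \<tau>2"
    proof (cases "z = 0")
      case True
      then have "l \<tau> = log q (absC \<tau>)" for \<tau>
        by (simp add: l_def max_absorb1)
      with interp show ?thesis
        by (simp only: order_refl)
    next
      case False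
      have l: "l \<tau> = max (log q (absC \<tau>)) (log q (absC z))" if "\<tau> \<noteq> 0" for \<tau>
        using that False q_gt_1 by (auto simp: l_def max_def)
      then have ge: "log q (absC \<tau>) \<le> l \<tau>" "log q (absC z) \<le> l \<tau>" if "\<tau> \<noteq> 0" for \<tau>
        using that by auto
      have "x * c \<le> x * l \<tau>0" if "c \<le> l \<tau>0" for c
        using that \<open>x \<ge> 0\<close> by (rule mult_left_mono)
      moreover have "y * c \<le> y * l \<tau>2" if "c \<le> l \<tau>2" for c
        using that \<open>y \<ge> 0\<close> by (rule mult_left_mono)
      ultimately have "x * log q (absC \<tau>0) + y * log q (absC \<tau>2) \<le> x * l \<tau>0 + y * l \<tau>2"
        and "x * log q (absC z) + y * log q (absC z) \<le> x * l \<tau>0 + y * l \<tau>2"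
        using ge nz by (metis add_mono)+
      then show ?thesis
        unfolding l[OF nz(2)] max_def interp[symmetric] distrib_right[of x y "log q (absC z)", symmetric]
        by (split if_split) blast
    qed
    with add.IH show ?case
      by (simp add: step distrib_left)
  qed (simp add: \<psi>_def)
  moreover have "log q (absC (poly p \<tau>)) = log q (absC a) + \<psi> Z \<tau>" if "\<tau> \<in> {\<tau>0, \<tau>1, \<tau>2}" for \<tau>
  proof -
    have "absC a > 0"
      using abs_p[OF that] by simp
    with pos[OF that, of Z] show ?thesis
      unfolding \<psi>_def conjunct1[OF abs_p[OF that]] by (intro log_mult_pos)
  qed
  moreover have "(x + y) * (c + u) \<le> x * (c + v) + y * (c + w)"
    if "(x + y) * u \<le> x * v + y * w" for c u v w
    using that by (simp add: algebra_simps)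
  ultimately show ?thesis
    by (simp only: insert_iff simp_thms)
qed

section \<open>Strictly convergent power series\<close>

lemma strictly_convergent_finite:
  assumes "finite J" and I: "\<And>k i. k \<in> J \<Longrightarrow> i \<notin> I \<Longrightarrow> \<alpha> k i = 0"
    and F: "\<And>x. x \<in> S \<Longrightarrow> F x = (\<Sum>k\<in>J. c k * (\<Prod>i\<in>I. h i x ^ \<alpha> k i))"
  shows "strictly_convergent S I h (F :: 'p \<Rightarrow> 'c)"
proof -
  define c' where "c' = (\<lambda>\<beta>. \<Sum>k\<in>{k \<in> J. \<alpha> k = \<beta>}. c k)"
  have supp: "\<beta> \<in> \<alpha> ` J" if "c' \<beta> \<noteq> 0" for \<beta>
  proof (rule ccontr)
    assume "\<beta> \<notin> \<alpha> ` J"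
    then have "{k \<in> J. \<alpha> k = \<beta>} = {}"
      by blast
    with that show False
      by (simp add: c'_def)
  qed
  have "finite {\<beta>. (\<forall>i. i \<notin> I \<longrightarrow> \<beta> i = 0) \<and> absC (c' \<beta>) \<ge> e}" if "e > 0" for e
  proof (rule finite_subset)
    show "{\<beta>. (\<forall>i. i \<notin> I \<longrightarrow> \<beta> i = 0) \<and> absC (c' \<beta>) \<ge> e} \<subseteq> \<alpha> ` J"
      using supp that by force
  qed (use \<open>finite J\<close> in simp)
  moreover have "((\<lambda>\<beta>. c' \<beta> * (\<Prod>i\<in>I. h i x ^ \<beta> i)) has_sum F x) {\<beta>. \<forall>i. i \<notin> I \<longrightarrow> \<beta> i = 0}"
    if "x \<in> S" for x
  proof -
    have "F x = (\<Sum>\<beta>\<in>\<alpha> ` J. \<Sum>k\<in>{k \<in> J. \<alpha> k = \<beta>}. c k * (\<Prod>i\<in>I. h i x ^ \<alpha> k i))"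
      unfolding F[OF that] by (rule sum.image_gen[OF \<open>finite J\<close>])
    also have "\<dots> = (\<Sum>\<beta>\<in>\<alpha> ` J. c' \<beta> * (\<Prod>i\<in>I. h i x ^ \<beta> i))"
      by (intro sum.cong) (simp_all add: c'_def sum_distrib_right)
    finally have "((\<lambda>\<beta>. c' \<beta> * (\<Prod>i\<in>I. h i x ^ \<beta> i)) has_sum F x) (\<alpha> ` J)"
      using \<open>finite J\<close> by (intro has_sum_finiteI) simp_all
    then show ?thesis
    proof (rule has_sum_cong_neutral[THEN iffD1, rotated -1])
      show "c' \<beta> * (\<Prod>i\<in>I. h i x ^ \<beta> i) = 0" if "\<beta> \<in> {\<beta>. \<forall>i. i \<notin> I \<longrightarrow> \<beta> i = 0} - \<alpha> ` J" for \<beta>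
        using that supp[of \<beta>] by auto
      show "c' \<beta> * (\<Prod>i\<in>I. h i x ^ \<beta> i) = 0" if "\<beta> \<in> \<alpha> ` J - {\<beta>. \<forall>i. i \<notin> I \<longrightarrow> \<beta> i = 0}" for \<beta>
        using that I by auto
    qed simp
  qed
  ultimately show ?thesis
    unfolding strictly_convergent_def by blast
qed

lemma strictly_convergent_truncate:
  fixes F :: "'p \<Rightarrow> 'c" and I :: "'i set"
  assumes "strictly_convergent S I h F" and h: "\<And>i x. i \<in> I \<Longrightarrow> x \<in> S \<Longrightarrow> absC (h i x) \<le> 1" and "e > 0"
  obtains c Y where "finite Y" "\<And>x. x \<in> S \<Longrightarrow> absC (F x - (\<Sum>\<alpha>\<in>Y. c \<alpha> * (\<Prod>i\<in>I. h i x ^ \<alpha> i))) < e"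
proof -
  define A where "A = {\<alpha> :: 'i \<Rightarrow> nat. \<forall>i. i \<notin> I \<longrightarrow> \<alpha> i = 0}"
  obtain c where c:
    "(\<forall>e>0. finite {\<alpha>. (\<forall>i. i \<notin> I \<longrightarrow> \<alpha> i = 0) \<and> absC (c \<alpha>) \<ge> e}) \<and>
     (\<forall>x\<in>S. ((\<lambda>\<alpha>. c \<alpha> * (\<Prod>i\<in>I. h i x ^ \<alpha> i)) has_sum F x) {\<alpha>. \<forall>i. i \<notin> I \<longrightarrow> \<alpha> i = 0})"
    using assms(1) unfolding strictly_convergent_def by - (erule exE, rule that)
  note fin = conjunct1[OF c, rule_format] and F = conjunct2[OF c, folded A_def, rule_format]
  define Y where "Y = {\<alpha>. (\<forall>i. i \<notin> I \<longrightarrow> \<alpha> i = 0) \<and> absC (c \<alpha>) \<ge> e}"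
  have Y: "finite Y" "Y \<subseteq> A"
    using fin[OF \<open>e > 0\<close>] by (auto simp: Y_def A_def)
  have "absC (F x - (\<Sum>\<alpha>\<in>Y. c \<alpha> * (\<Prod>i\<in>I. h i x ^ \<alpha> i))) < e" if x: "x \<in> S" for x
  proof -
    define g where "g = (\<lambda>\<alpha>. c \<alpha> * (\<Prod>i\<in>I. h i x ^ \<alpha> i))"
    have "eventually (\<lambda>Z. dist (sum g Z) (F x) < e) (finite_subsets_at_top A)"
      using F[OF x] \<open>e > 0\<close> unfolding has_sum_def g_def by (rule tendstoD)
    then obtain Z0 where Z0: "finite Z0 \<and> Z0 \<subseteq> A \<and>
        (\<forall>Z. finite Z \<and> Z0 \<subseteq> Z \<and> Z \<subseteq> A \<longrightarrow> dist (sum g Z) (F x) < e)"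
      unfolding eventually_finite_subsets_at_top by (rule exE)
    define Z where "Z = Z0 \<union> Y"
    have Z: "finite Z" "Y \<subseteq> Z" "Z \<subseteq> A"
      using Z0 Y by (auto simp: Z_def)
    have 1: "absC (F x - sum g Z) < e"
      using conjunct2[OF conjunct2[OF Z0], rule_format, of Z] Z
      by (simp add: Z_def dist_absC absC_diff_commute[of "F x"])
    have "absC (g \<alpha>) < e" if "\<alpha> \<in> Z - Y" for \<alpha>
    proof -
      have "absC (\<Prod>i\<in>I. h i x ^ \<alpha> i) \<le> 1"
        unfolding absC_prod absC_power using h[OF _ x] by (intro prod_le_1) (auto simp: power_le_one)
      then have "absC (g \<alpha>) \<le> absC (c \<alpha>)"
        unfolding g_def absC_mult by (intro mult_left_le) auto
      also have "\<dots> < e"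
        using that Z(3) by (auto simp: Y_def A_def)
      finally show ?thesis .
    qed
    then have 2: "absC (sum g (Z - Y)) < e"
      using \<open>e > 0\<close> by (intro absC_sum_less) auto
    have eq: "F x - sum g Y = (F x - sum g Z) + sum g (Z - Y)"
      using sum.subset_diff[OF Z(2,1), of g] by simp
    have "absC (F x - sum g Y) < e"
      unfolding eq by (rule le_less_trans[OF absC_ultrametric]) (simp add: 1 2)
    then show ?thesis
      by (simp add: g_def)
  qed
  then show ?thesis
    using that Y(1) by blast
qed

lemma strictly_convergent_bounded:
  fixes F :: "'p \<Rightarrow> 'c"
  assumes "strictly_convergent S I h F" and h: "\<And>i x. i \<in> I \<Longrightarrow> x \<in> S \<Longrightarrow> absC (h i x) \<le> 1"
  obtains b where "b > 0" "\<And>x. x \<in> S \<Longrightarrow> absC (F x) \<le> b"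
proof -
  obtain c Y where Y: "finite Y"
    and F: "\<And>x. x \<in> S \<Longrightarrow> absC (F x - (\<Sum>\<alpha>\<in>Y. c \<alpha> * (\<Prod>i\<in>I. h i x ^ \<alpha> i))) < 1"
    using strictly_convergent_truncate[OF assms zero_less_one] by metis
  define b where "b = 1 + (\<Sum>\<alpha>\<in>Y. absC (c \<alpha>))"
  have sum_nonneg: "(\<Sum>\<alpha>\<in>Y. absC (c \<alpha>)) \<ge> 0"
    by (intro sum_nonneg) auto
  have "absC (F x) \<le> b" if x: "x \<in> S" for x
  proof -
    define s where "s = (\<Sum>\<alpha>\<in>Y. c \<alpha> * (\<Prod>i\<in>I. h i x ^ \<alpha> i))"
    have "absC s \<le> b"
      unfolding s_def
    proof (rule absC_sum_le)
      fix \<alpha> assume "\<alpha> \<in> Y"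
      have "absC (\<Prod>i\<in>I. h i x ^ \<alpha> i) \<le> 1"
        unfolding absC_prod absC_power using h[OF _ x] by (intro prod_le_1) (auto simp: power_le_one)
      then have "absC (c \<alpha> * (\<Prod>i\<in>I. h i x ^ \<alpha> i)) \<le> absC (c \<alpha>)"
        unfolding absC_mult by (intro mult_left_le) auto
      also have "\<dots> \<le> (\<Sum>\<alpha>\<in>Y. absC (c \<alpha>))"
        using \<open>\<alpha> \<in> Y\<close> Y by (intro member_le_sum) auto
      finally show "absC (c \<alpha> * (\<Prod>i\<in>I. h i x ^ \<alpha> i)) \<le> b"
        by (simp add: b_def)
    qed (use sum_nonneg in \<open>simp add: b_def\<close>)
    moreover have "absC (F x - s) \<le> b"
      using F[OF x] sum_nonneg by (simp add: s_def b_def)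
    ultimately show ?thesis
      using absC_ultrametric[of "F x - s" s] by simp
  qed
  moreover have "b > 0"
    using sum_nonneg by (simp add: b_def)
  ultimately show ?thesis
    using that by blast
qed

section \<open>A rational domain around a simplex\<close>

lemma absK_diff_ultrametric: "absK (a - b :: 'k fls) \<le> max (absK a) (absK b)"
  using absC_diff_ultrametric[of "emb a" "emb b"] by (simp only: absC_extends flip: emb_diff)

lemma absK_eq_1_if_close: "absK (a :: 'k fls) = 1 \<Longrightarrow> absK (a - b) < 1 \<Longrightarrow> absK b = 1"
  using absC_eq_if_close[of "emb b" "emb a"] absC_diff_commute[of "emb a" "emb b"]
  by (simp only: absC_extends flip: emb_diff)

lemma ex_finite_net: "\<exists>R. finite R \<and> (\<forall>a :: 'k fls. absK a \<le> 1 \<longrightarrow> (\<exists>b\<in>R. absK (a - b) \<le> inverse q ^ M))"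
proof (induction M)
  case 0
  show ?case
    by (intro exI[of _ "{0}"]) simp
next
  case (Suc M)
  then obtain R where R: "finite R" "\<And>a :: 'k fls. absK a \<le> 1 \<Longrightarrow> \<exists>b\<in>R. absK (a - b) \<le> inverse q ^ M"
    by blast
  define R' where "R' = (\<lambda>(c :: 'k, b). fls_const c + fls_X * b) ` (UNIV \<times> R)"
  have "\<exists>b\<in>R'. absK (a - b) \<le> inverse q ^ Suc M" if a: "absK a \<le> 1" for a :: "'k fls"
  proof -
    define a1 where "a1 = (a - fls_const (fls_nth a 0)) / fls_X"
    have a1: "fls_X * a1 = a - fls_const (fls_nth a 0)"
      unfolding a1_def times_divide_eq_right using fls_X_nonzero by (rule nonzero_mult_div_cancel_left)
    have "absK a1 = absK (a - fls_const (fls_nth a 0)) * q"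
      unfolding a1_def absK_divide absK_fls_X by (simp add: field_simps)
    also have "\<dots> \<le> inverse q * q"
      using fls_const_approx[OF a] by (intro mult_right_mono) auto
    finally have "absK a1 \<le> 1"
      using q_pos by simp
    then obtain b where b: "b \<in> R" "absK (a1 - b) \<le> inverse q ^ M"
      using R(2) by blast
    have "a - (fls_const (fls_nth a 0) + fls_X * b) = fls_X * (a1 - b)"
      unfolding right_diff_distrib a1 by simp
    then have "absK (a - (fls_const (fls_nth a 0) + fls_X * b)) = inverse q * absK (a1 - b)"
      by (simp only: absK_mult absK_fls_X)
    also have "\<dots> \<le> inverse q ^ Suc M"
      using b(2) unfolding power_Suc by (intro mult_left_mono) auto
    finally show ?thesis
      using b(1) unfolding R'_def by (intro bexI[OF _ image_eqI[of _ _ "(fls_nth a 0, b)"]]) auto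
  qed
  moreover have "finite R'"
    using R(1) by (simp add: R'_def)
  ultimately show ?case
    by blast
qed

definition unit_vector :: "'k fls^'r::finite \<Rightarrow> bool" where
  "unit_vector v \<longleftrightarrow> (\<forall>j. absK (v $ j) \<le> 1) \<and> (\<exists>j. absK (v $ j) = 1)"

lemma ex_finite_unit_net:
  assumes "M > 0"
  shows "\<exists>R :: ('k fls^'r::finite) set. finite R \<and> (\<forall>b\<in>R. unit_vector b) \<and>
    (\<forall>v. unit_vector v \<longrightarrow> (\<exists>b\<in>R. \<forall>j. absK ((v - b) $ j) \<le> inverse q ^ M))"
proof -
  obtain R0 where R0: "finite R0" "\<And>a :: 'k fls. absK a \<le> 1 \<Longrightarrow> \<exists>b\<in>R0. absK (a - b) \<le> inverse q ^ M"
    using ex_finite_net[of M] by blast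
  define R where "R = {b :: 'k fls^'r. (\<forall>j. b $ j \<in> R0) \<and> unit_vector b}"
  have "R \<subseteq> vec_lambda ` (UNIV \<rightarrow>\<^sub>E R0)"
  proof
    fix b assume "b \<in> R"
    then have "vec_nth b \<in> UNIV \<rightarrow>\<^sub>E R0"
      by (auto simp: R_def)
    then show "b \<in> vec_lambda ` (UNIV \<rightarrow>\<^sub>E R0)"
      by (metis image_eqI vec_nth_inverse)
  qed
  then have "finite R"
    by (rule finite_subset) (use R0(1) in \<open>auto intro!: finite_imageI finite_PiE\<close>)
  moreover have "\<exists>b\<in>R. \<forall>j. absK ((v - b) $ j) \<le> inverse q ^ M" if v: "unit_vector v" for v
  proof -
    have "\<forall>j. \<exists>b\<in>R0. absK (v $ j - b) \<le> inverse q ^ M"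
      using R0(2) v by (simp add: unit_vector_def)
    then obtain b where b: "\<And>j. b j \<in> R0" "\<And>j. absK (v $ j - b j) \<le> inverse q ^ M"
      by metis
    have "inverse q ^ M < 1"
      using q_gt_1 assms by (simp add: power_less_one_iff inverse_less_1_iff)
    then have close: "absK (v $ j - b j) < 1" for j
      using b(2)[of j] by simp
    have "absK (b j) \<le> 1" for j
      using absK_diff_ultrametric[of "v $ j" "v $ j - b j"] close[of j] v
      by (simp add: unit_vector_def) (metis le_max_iff_disj less_imp_le order_trans)
    moreover have "\<exists>j. absK (b j) = 1"
      using v close absK_eq_1_if_close by (metis unit_vector_def)
    ultimately have "(\<chi> j. b j) \<in> R"
      using b(1) by (simp add: R_def unit_vector_def)
    then show ?thesis
      using b(2) by (intro bexI[of _ "\<chi> j. b j"]) simp_all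
  qed
  ultimately show ?thesis
    by (intro exI[of _ R]) (auto simp: R_def)
qed

lemma unit_vector_multiple:
  assumes "v \<noteq> (0 :: 'k fls^'r::finite)"
  obtains c where "c \<noteq> 0" "unit_vector (c *s v)"
proof -
  have "Max (range (\<lambda>j. absK (v $ j))) \<in> range (\<lambda>j. absK (v $ j))"
    by (intro Max_in) auto
  then obtain i where i: "absK (v $ i) = Max (range (\<lambda>j. absK (v $ j)))"
    by force
  have le: "absK (v $ j) \<le> absK (v $ i)" for j
    unfolding i by (intro Max_ge) auto
  obtain j where "v $ j \<noteq> 0"
    using assms by (auto simp: vec_eq_iff)
  then have "absK (v $ j) > 0"
    using absK_nonneg[of "v $ j"] by (simp add: less_le)
  with le[of j] have pos: "absK (v $ i) > 0"
    by linarith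
  then have "v $ i \<noteq> 0"
    by auto
  moreover have "absK ((inverse (v $ i) *s v) $ j) = absK (v $ j) / absK (v $ i)" for j
    by (simp only: vector_smult_component absK_mult absK_inverse divide_inverse mult.commute)
  then have "unit_vector (inverse (v $ i) *s v)"
    unfolding unit_vector_def using pos le by (auto simp: divide_le_eq intro!: exI[of _ i])
  ultimately show ?thesis
    using that[of "inverse (v $ i)"] by (metis nonzero_imp_inverse_nonzero)
qed

lemma tate_fun_prod_lform:
  fixes a :: "nat \<Rightarrow> 'k fls^'r::finite"
  assumes "finite I" "\<rho> \<noteq> 0"
  shows "tate_fun l \<rho> (\<lambda>z. e * (\<Prod>i\<in>I. lform (a i) z))"
  unfolding tate_fun_def
proof (rule strictly_convergent_finite)
  show "finite (I \<rightarrow>\<^sub>E (UNIV :: 'r set))"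
    using assms by (intro finite_PiE) auto
  show "(if j = l then 0 else card {i \<in> I. \<phi> i = j}) = 0" if "j \<notin> - {l}" for j and \<phi> :: "nat \<Rightarrow> 'r"
    using that by simp
  fix z :: "'c^'r" assume "z \<in> chart_ball l \<rho>"
  then have z: "z $ l = 1"
    by (simp add: chart_ball_def)
  define h where "h = (\<lambda>j. if j = l then 1 else z $ j / \<rho>)"
  have z_eq: "z $ j = (if j = l then 1 else \<rho>) * h j" for j
    using z assms by (simp add: h_def)
  have "(\<Prod>i\<in>I. lform (a i) z) = (\<Sum>\<phi>\<in>I \<rightarrow>\<^sub>E UNIV. \<Prod>i\<in>I. emb (a i $ \<phi> i) * z $ \<phi> i)"
    unfolding lin_form_def using assms by (intro prod_sum_PiE) auto
  also have "\<dots> = (\<Sum>\<phi>\<in>I \<rightarrow>\<^sub>E UNIV. (\<Prod>i\<in>I. emb (a i $ \<phi> i) * (if \<phi> i = l then 1 else \<rho>)) *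
      (\<Prod>j\<in>- {l}. (z $ j / \<rho>) ^ (if j = l then 0 else card {i \<in> I. \<phi> i = j})))"
  proof (rule sum.cong[OF refl])
    fix \<phi> :: "nat \<Rightarrow> 'r"
    have "(\<Prod>i\<in>I. h (\<phi> i)) = (\<Prod>j\<in>UNIV. \<Prod>i\<in>{i \<in> I. \<phi> i = j}. h (\<phi> i))"
      using assms by (intro prod.group[symmetric]) auto
    also have "\<dots> = (\<Prod>j\<in>UNIV. h j ^ card {i \<in> I. \<phi> i = j})"
      by (intro prod.cong) simp_all
    also have "\<dots> = (\<Prod>j\<in>- {l}. h j ^ card {i \<in> I. \<phi> i = j})"
      by (intro prod.mono_neutral_right) (auto simp: h_def)
    also have "\<dots> = (\<Prod>j\<in>- {l}. (z $ j / \<rho>) ^ (if j = l then 0 else card {i \<in> I. \<phi> i = j}))"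
      by (intro prod.cong) (auto simp: h_def)
    finally show "(\<Prod>i\<in>I. emb (a i $ \<phi> i) * z $ \<phi> i) =
        (\<Prod>i\<in>I. emb (a i $ \<phi> i) * (if \<phi> i = l then 1 else \<rho>)) *
        (\<Prod>j\<in>- {l}. (z $ j / \<rho>) ^ (if j = l then 0 else card {i \<in> I. \<phi> i = j}))"
      unfolding z_eq mult.assoc[symmetric] by (simp only: prod.distrib)
  qed
  finally show "e * (\<Prod>i\<in>I. lform (a i) z) =
      (\<Sum>\<phi>\<in>I \<rightarrow>\<^sub>E UNIV. (e * (\<Prod>i\<in>I. emb (a i $ \<phi> i) * (if \<phi> i = l then 1 else \<rho>))) *
        (\<Prod>j\<in>- {l}. (z $ j / \<rho>) ^ (if j = l then 0 else card {i \<in> I. \<phi> i = j})))"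
    by (simp only: sum_distrib_left mult.assoc)
qed

text \<open>
  The rational subdomain \<open>{z. \<forall>i<n. absC \<epsilon> \<le> absC (lform (a i) z)}\<close> of a ball, for \<open>g\<close> the product of
  the linear forms; the function with index \<open>n\<close> excludes common zeros.
\<close>

definition form_prod :: "nat \<Rightarrow> (nat \<Rightarrow> 'k fls^'r::finite) \<Rightarrow> 'c^'r \<Rightarrow> 'c" where
  "form_prod n a z = (\<Prod>i<n. lform (a i) z)"

definition form_num :: "nat \<Rightarrow> (nat \<Rightarrow> 'k fls^'r::finite) \<Rightarrow> 'c \<Rightarrow> nat \<Rightarrow> 'c^'r \<Rightarrow> 'c" where
  "form_num n a \<epsilon> i z = (if i = n then \<epsilon> ^ n else \<epsilon> * (\<Prod>i'\<in>{..<n} - {i}. lform (a i') z))"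

lemma rational_data_forms:
  fixes a :: "nat \<Rightarrow> 'k fls^'r::finite"
  assumes "\<rho> \<noteq> 0" "\<epsilon> \<noteq> 0"
  shows "rational_data l \<rho> (Suc n) (form_prod n a) (form_num n a \<epsilon>)"
proof -
  have "tate_fun l \<rho> (form_prod n a)"
    using tate_fun_prod_lform[of "{..<n}" \<rho> l 1 a] assms by (simp add: form_prod_def[abs_def])
  moreover have "tate_fun l \<rho> (form_num n a \<epsilon> i)" for i
    using tate_fun_prod_lform[of "{}" \<rho> l "\<epsilon> ^ n" a] tate_fun_prod_lform[of "{..<n} - {i}" \<rho> l \<epsilon> a] assms
    by (cases "i = n") (simp_all add: form_num_def[abs_def])
  moreover have "\<exists>i<Suc n. form_num n a \<epsilon> i z \<noteq> 0" for z
    using assms by (intro exI[of _ n]) (simp add: form_num_def)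
  ultimately show ?thesis
    using assms by (simp add: rational_data_def)
qed

lemma mem_rational_dom_forms_iff:
  fixes a :: "nat \<Rightarrow> 'k fls^'r::finite"
  assumes "\<epsilon> \<noteq> 0"
  shows "z \<in> rational_dom l \<rho> (Suc n) (form_prod n a) (form_num n a \<epsilon>) \<longleftrightarrow>
    z \<in> chart_ball l \<rho> \<and> (\<forall>i<n. absC \<epsilon> \<le> absC (lform (a i) z))"
proof -
  have split: "form_prod n a z = lform (a i) z * (\<Prod>i'\<in>{..<n} - {i}. lform (a i') z)" if "i < n" for i
    unfolding form_prod_def using that by (intro prod.remove) auto
  have "(\<forall>i<Suc n. absC (form_num n a \<epsilon> i z) \<le> absC (form_prod n a z)) \<longleftrightarrow>
      (\<forall>i<n. absC \<epsilon> \<le> absC (lform (a i) z))"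
  proof
    assume le: "\<forall>i<Suc n. absC (form_num n a \<epsilon> i z) \<le> absC (form_prod n a z)"
    show "\<forall>i<n. absC \<epsilon> \<le> absC (lform (a i) z)"
    proof (intro allI impI)
      fix i assume i: "i < n"
      have "absC (form_prod n a z) \<ge> absC (\<epsilon> ^ n)"
        using le[rule_format, of n] by (simp add: form_num_def)
      moreover have "absC (\<epsilon> ^ n) > 0"
        using assms by simp
      ultimately have "absC (form_prod n a z) > 0"
        by linarith
      then have "form_prod n a z \<noteq> 0"
        by simp
      then have "absC (\<Prod>i'\<in>{..<n} - {i}. lform (a i') z) > 0"
        unfolding split[OF i] by simp
      moreover have "absC \<epsilon> * absC (\<Prod>i'\<in>{..<n} - {i}. lform (a i') z) \<le>
          absC (lform (a i) z) * absC (\<Prod>i'\<in>{..<n} - {i}. lform (a i') z)"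
        using le[rule_format, of i] i unfolding split[OF i] by (simp add: form_num_def absC_mult)
      ultimately show "absC \<epsilon> \<le> absC (lform (a i) z)"
        by (rule mult_right_le_imp_le[rotated])
    qed
  next
    assume le: "\<forall>i<n. absC \<epsilon> \<le> absC (lform (a i) z)"
    show "\<forall>i<Suc n. absC (form_num n a \<epsilon> i z) \<le> absC (form_prod n a z)"
    proof (intro allI impI)
      fix i assume "i < Suc n"
      show "absC (form_num n a \<epsilon> i z) \<le> absC (form_prod n a z)"
      proof (cases "i = n")
        case True
        have "(\<Prod>i<n. absC \<epsilon>) \<le> (\<Prod>i<n. absC (lform (a i) z))"
          using le by (intro prod_mono) auto
        then show ?thesis
          using True by (simp add: form_num_def form_prod_def absC_power absC_prod)
      next
        case False
        then have "i < n"
          using \<open>i < Suc n\<close> by simp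
        then show ?thesis
          using le split[of i] False by (simp add: form_num_def absC_mult mult_right_mono)
      qed
    qed
  qed
  then show ?thesis
    by (simp add: rational_dom_def)
qed

lemma form_num_divide:
  assumes "i < Suc n" "\<And>i. i < n \<Longrightarrow> lform (a i) z \<noteq> 0"
  shows "form_num n a \<epsilon> i z / form_prod n a z = (if i = n then \<Prod>i<n. \<epsilon> / lform (a i) z else \<epsilon> / lform (a i) z)"
proof (cases "i = n")
  case True
  then show ?thesis
    by (simp add: form_num_def form_prod_def prod_dividef)
next
  case False
  then have "form_prod n a z = lform (a i) z * (\<Prod>i'\<in>{..<n} - {i}. lform (a i') z)"
    unfolding form_prod_def using assms(1) by (intro prod.remove) auto
  moreover have "(\<Prod>i'\<in>{..<n} - {i}. lform (a i') z) \<noteq> 0"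
    using assms(2) by (simp add: prod_zero_iff)
  ultimately show ?thesis
    using False by (simp add: form_num_def)
qed

definition band :: "('k fls^'r::finite \<Rightarrow> real) \<Rightarrow> ('c^'r) set" where
  "band N = {y. \<forall>v. N v \<le> absC (lform v y) \<and> absC (lform v y) \<le> q * N v}"

lemma ex_rational_dom:
  fixes N :: "'k fls^'r::finite \<Rightarrow> real" and l :: 'r
  assumes "\<kappa> > 0" and \<kappa>: "\<And>v j. \<kappa> * absK (v $ j) \<le> N v"
  shows "\<exists>\<rho> \<epsilon> n a. \<rho> \<noteq> 0 \<and> \<epsilon> \<noteq> 0 \<and> (\<forall>i<n. a i \<noteq> 0) \<and>
    (\<forall>z\<in>rational_dom l \<rho> (Suc n) (form_prod n a) (form_num n a \<epsilon>). \<forall>v. lform v z = 0 \<longrightarrow> v = 0) \<and>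
    (\<forall>y\<in>band N. inverse (y $ l) *s y \<in> rational_dom l \<rho> (Suc n) (form_prod n a) (form_num n a \<epsilon>))"
proof -
  define e :: "'r \<Rightarrow> 'k fls^'r" where "e = (\<lambda>j. axis j 1)"
  have N_e: "N (e j) > 0" for j
    using \<kappa>[of "e j" j] \<open>\<kappa> > 0\<close> by (simp add: e_def)
  define x1 where "x1 = (\<Sum>j\<in>UNIV. q * N (e j) / N (e l))"
  define x2 where "x2 = q * N (e l) / \<kappa>"
  have x1: "q * N (e j) / N (e l) \<le> x1" for j
    unfolding x1_def using N_e by (intro member_le_sum) (auto simp: less_imp_le)
  have x2: "x2 > 0"
    using N_e \<open>\<kappa> > 0\<close> by (simp add: x2_def)
  obtain t where t: "x1 + x2 < q ^ t"
    using real_arch_pow[OF q_gt_1] by blast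
  have x1_nonneg: "x1 \<ge> 0"
    using x1[of l] N_e[of l] q_pos by (simp add: order_trans[OF q_nonneg])
  have t1: "x1 \<le> q ^ t" and t2: "x2 \<le> q ^ t"
    using t x1_nonneg x2 by auto
  have q_t: "q ^ t \<ge> 1"
    by simp
  define \<rho> where "\<rho> = inverse (emb fls_X) ^ t"
  define \<epsilon> where "\<epsilon> = emb fls_X ^ t"
  have abs_X: "absC (emb fls_X) = inverse q"
    by (simp add: absC_extends)
  have \<rho>: "absC \<rho> = q ^ t" and \<epsilon>: "absC \<epsilon> = inverse (q ^ t)"
    by (simp_all add: \<rho>_def \<epsilon>_def absC_power abs_X power_inverse)
  have nz: "\<rho> \<noteq> 0" "\<epsilon> \<noteq> 0"
    by (simp_all add: \<rho>_def \<epsilon>_def)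
  obtain R :: "('k fls^'r) set" where R: "finite R" "\<And>b. b \<in> R \<Longrightarrow> unit_vector b"
    "\<And>v. unit_vector v \<Longrightarrow> \<exists>b\<in>R. \<forall>j. absK ((v - b) $ j) \<le> inverse q ^ (2 * t + 1)"
    using ex_finite_unit_net[of "2 * t + 1"] by (metis add_gr_0 zero_less_one)
  obtain n a where Ra: "R = a ` {i. i < (n :: nat)}"
    using R(1) unfolding finite_conv_nat_seg_image by blast
  have a: "unit_vector (a i)" if "i < n" for i
    using R(2) Ra that by blast
  have a_nz: "a i \<noteq> 0" if "i < n" for i
    using a[OF that] by (auto simp: unit_vector_def)
  define dom where "dom = rational_dom l \<rho> (Suc n) (form_prod n a) (form_num n a \<epsilon>)"
  have dom_iff: "z \<in> dom \<longleftrightarrow> z \<in> chart_ball l \<rho> \<and> (\<forall>i<n. absC \<epsilon> \<le> absC (lform (a i) z))" for z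
    unfolding dom_def by (rule mem_rational_dom_forms_iff[OF nz(2)])
  have "v = 0" if z: "z \<in> dom" and v: "lform v z = 0" for z v
  proof (rule ccontr)
    assume "v \<noteq> 0"
    then obtain c where c: "c \<noteq> 0" "unit_vector (c *s v)"
      by (rule unit_vector_multiple)
    then obtain b where b: "b \<in> R" "\<And>j. absK ((c *s v - b) $ j) \<le> inverse q ^ (2 * t + 1)"
      using R(3) by blast
    have "z \<in> chart_ball l \<rho>"
      using z by (simp add: dom_iff)
    then have "absC (z $ j) \<le> q ^ t" for j
      using q_t by (cases "j = l") (auto simp: chart_ball_def \<rho>)
    then have "absC (lform (c *s v - b) z) \<le> inverse q ^ (2 * t + 1) * q ^ t"
      using b(2) by (intro absC_lform_le) auto
    also have "inverse q ^ (2 * t + 1) * q ^ t = inverse (q ^ t) * inverse q"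
      by (simp only: power_add power_inverse mult_2 power_one_right) (simp add: field_simps)
    also have "\<dots> < inverse (q ^ t)"
      using q_gt_1 by (simp add: inverse_less_1_iff mult_less_cancel_left1)
    also have "\<dots> \<le> absC (lform b z)"
    proof -
      obtain i where "i < n" "b = a i"
        using b(1) Ra by auto
      then show ?thesis
        using z by (simp add: dom_iff \<epsilon>)
    qed
    also have "lform (c *s v - b) z = - lform b z"
      by (simp add: lform_diff_left lform_scale_left v)
    finally show False
      by simp
  qed
  then have "\<forall>z\<in>dom. \<forall>v. lform v z = 0 \<longrightarrow> v = 0"
    by blast
  moreover have "inverse (y $ l) *s y \<in> dom" if y: "y \<in> band N" for y
  proof -
    have y_e: "N (e j) \<le> absC (y $ j)" "absC (y $ j) \<le> q * N (e j)" for j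
      using y lform_axis[of j y] unfolding band_def e_def mem_Collect_eq by metis+
    have y_l: "y $ l \<noteq> 0"
      using y_e(1)[of l] N_e[of l] by auto
    have "absC ((inverse (y $ l) *s y) $ j) \<le> absC \<rho>" for j
    proof -
      have "absC ((inverse (y $ l) *s y) $ j) = absC (y $ j) / absC (y $ l)"
        by (simp add: absC_mult divide_inverse)
      also have "\<dots> \<le> q * N (e j) / N (e l)"
        using y_e N_e by (intro frac_le) (auto simp: less_imp_le)
      also have "\<dots> \<le> absC \<rho>"
        using x1[of j] t1 by (simp add: \<rho>)
      finally show ?thesis .
    qed
    moreover have "absC \<epsilon> \<le> absC (lform (a i) (inverse (y $ l) *s y))" if i: "i < n" for i
    proof -
      obtain j where "absK (a i $ j) = 1"
        using a[OF i] by (auto simp: unit_vector_def)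
      then have "\<kappa> \<le> N (a i)"
        using \<kappa>[of "a i" j] by simp
      also have "\<dots> \<le> absC (lform (a i) y)"
        using y by (simp add: band_def)
      finally have "\<kappa> \<le> absC (lform (a i) y)" .
      then have "\<kappa> / (q * N (e l)) \<le> absC (lform (a i) y) / absC (y $ l)"
        using y_e[of l] N_e[of l] \<open>\<kappa> > 0\<close> by (intro frac_le) auto
      moreover have "inverse (q ^ t) \<le> inverse x2"
        using t2 x2 by (intro le_imp_inverse_le)
      moreover have "inverse x2 = \<kappa> / (q * N (e l))"
        by (simp add: x2_def)
      ultimately show ?thesis
        by (simp add: \<epsilon> lform_scale absC_mult divide_inverse mult.commute)
    qed
    ultimately show ?thesis
      unfolding dom_iff chart_ball_def using y_l by simp
  qed
  ultimately show ?thesis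
    using nz a_nz unfolding dom_def by (intro exI[of _ \<rho>] exI[of _ \<epsilon>] exI[of _ n] exI[of _ a]) simp
qed

section \<open>Units on lines\<close>

lemma unit_affinoid_fun_truncate:
  fixes f :: "nat \<Rightarrow> 'c^'r::finite \<Rightarrow> 'c"
  assumes data: "rational_data l \<rho> m g f" and F: "affinoid_fun l \<rho> m g f F" and G: "affinoid_fun l \<rho> m g f G"
    and FG: "\<forall>z\<in>rational_dom l \<rho> m g f. F z * G z = 1"
  shows "\<exists>\<delta> c Y. \<delta> > 0 \<and> finite Y \<and>
    (\<forall>z\<in>rational_dom l \<rho> m g f. \<delta> \<le> absC (F z) \<and>
      absC (F z) = absC (\<Sum>\<alpha>\<in>Y. c \<alpha> * (\<Prod>i\<in>Inl ` (- {l}) \<union> Inr ` {..<m}.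
        case_sum (\<lambda>j z. z $ j / \<rho>) (\<lambda>i z. f i z / g z) i z ^ \<alpha> i)))"
proof -
  define S where "S = rational_dom l \<rho> m g f"
  define I where "I = Inl ` (- {l}) \<union> Inr ` {..<m}"
  define h where "h = case_sum (\<lambda>j (z :: 'c^'r). z $ j / \<rho>) (\<lambda>i z. f i z / g z)"
  have "\<rho> \<noteq> 0"
    using data by (simp add: rational_data_def)
  then have h: "absC (h i z) \<le> 1" if "i \<in> I" "z \<in> S" for i z
    using that by (auto simp: I_def h_def S_def rational_dom_def chart_ball_def absC_divide divide_le_eq_1 less_le)
  have F': "strictly_convergent S I h F" and G': "strictly_convergent S I h G"
    using F G by (simp_all add: affinoid_fun_def S_def I_def h_def)
  obtain b where b: "b > 0" "\<And>z. z \<in> S \<Longrightarrow> absC (G z) \<le> b"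
    by (rule strictly_convergent_bounded[OF G']) (use h in blast)+
  obtain c Y where Y: "finite Y"
    "\<And>z. z \<in> S \<Longrightarrow> absC (F z - (\<Sum>\<alpha>\<in>Y. c \<alpha> * (\<Prod>i\<in>I. h i z ^ \<alpha> i))) < inverse b"
    by (rule strictly_convergent_truncate[OF F', of "inverse b"]) (use h b(1) in \<open>blast intro: positive_imp_inverse_positive\<close>)+
  have main: "inverse b \<le> absC (F z) \<and> absC (F z) = absC (\<Sum>\<alpha>\<in>Y. c \<alpha> * (\<Prod>i\<in>I. h i z ^ \<alpha> i))" if z: "z \<in> S" for z
  proof -
    have "1 = absC (F z) * absC (G z)"
      using FG z by (simp add: S_def flip: absC_mult)
    also have "\<dots> \<le> absC (F z) * b"
      using b(2)[OF z] by (intro mult_left_mono) auto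
    finally have le: "inverse b \<le> absC (F z)"
      using b(1) by (simp add: field_simps)
    have "absC ((\<Sum>\<alpha>\<in>Y. c \<alpha> * (\<Prod>i\<in>I. h i z ^ \<alpha> i)) - F z) < absC (F z)"
      using Y(2)[OF z] le by (subst absC_diff_commute) linarith
    then show ?thesis
      using le absC_eq_if_close by metis
  qed
  show ?thesis
    unfolding S_def[symmetric] I_def[symmetric] h_def[symmetric]
  proof (intro exI conjI)
    show "inverse b > 0" "finite Y"
      using b(1) Y(1) by simp_all
    show "\<forall>z\<in>S. inverse b \<le> absC (F z) \<and> absC (F z) = absC (\<Sum>\<alpha>\<in>Y. c \<alpha> * (\<Prod>i\<in>I. h i z ^ \<alpha> i))"
      using main by (rule ballI)
  qed
qed

definition poly_quotient :: "'c set \<Rightarrow> 'c poly \<Rightarrow> ('c \<Rightarrow> 'c) \<Rightarrow> bool" where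
  "poly_quotient \<Theta> D \<phi> \<longleftrightarrow> (\<exists>k p. \<forall>\<tau>\<in>\<Theta>. \<phi> \<tau> * poly D \<tau> ^ k = poly p \<tau>)"

lemma poly_quotientI: "(\<And>\<tau>. \<tau> \<in> \<Theta> \<Longrightarrow> \<phi> \<tau> * poly D \<tau> ^ k = poly p \<tau>) \<Longrightarrow> poly_quotient \<Theta> D \<phi>"
  unfolding poly_quotient_def by blast

lemma poly_quotient_const: "poly_quotient \<Theta> D (\<lambda>_. c)"
  by (rule poly_quotientI[of _ _ _ 0 "[:c:]"]) simp

lemma poly_quotient_mult:
  assumes "poly_quotient \<Theta> D \<phi>" "poly_quotient \<Theta> D \<psi>"
  shows "poly_quotient \<Theta> D (\<lambda>\<tau>. \<phi> \<tau> * \<psi> \<tau>)"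
proof -
  obtain k p k' p' where *: "\<And>\<tau>. \<tau> \<in> \<Theta> \<Longrightarrow> \<phi> \<tau> * poly D \<tau> ^ k = poly p \<tau>"
    "\<And>\<tau>. \<tau> \<in> \<Theta> \<Longrightarrow> \<psi> \<tau> * poly D \<tau> ^ k' = poly p' \<tau>"
    using assms unfolding poly_quotient_def by blast
  have "\<phi> \<tau> * \<psi> \<tau> * poly D \<tau> ^ (k + k') = poly (p * p') \<tau>" if "\<tau> \<in> \<Theta>" for \<tau>
    unfolding poly_mult *(1)[OF that, symmetric] *(2)[OF that, symmetric] power_add by (simp only: mult_ac)
  then show ?thesis
    by (rule poly_quotientI)
qed

lemma poly_quotient_add:
  assumes "poly_quotient \<Theta> D \<phi>" "poly_quotient \<Theta> D \<psi>"
  shows "poly_quotient \<Theta> D (\<lambda>\<tau>. \<phi> \<tau> + \<psi> \<tau>)"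
proof -
  obtain k p k' p' where *: "\<And>\<tau>. \<tau> \<in> \<Theta> \<Longrightarrow> \<phi> \<tau> * poly D \<tau> ^ k = poly p \<tau>"
    "\<And>\<tau>. \<tau> \<in> \<Theta> \<Longrightarrow> \<psi> \<tau> * poly D \<tau> ^ k' = poly p' \<tau>"
    using assms unfolding poly_quotient_def by blast
  have "(\<phi> \<tau> + \<psi> \<tau>) * poly D \<tau> ^ (k + k') = poly (p * D ^ k' + p' * D ^ k) \<tau>" if "\<tau> \<in> \<Theta>" for \<tau>
    unfolding poly_mult poly_add poly_power *(1)[OF that, symmetric] *(2)[OF that, symmetric] power_add distrib_right
    by (simp only: mult_ac)
  then show ?thesis
    by (rule poly_quotientI)
qed

lemma poly_quotient_power: "poly_quotient \<Theta> D \<phi> \<Longrightarrow> poly_quotient \<Theta> D (\<lambda>\<tau>. \<phi> \<tau> ^ n)"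
  by (induction n) (simp_all add: poly_quotient_const poly_quotient_mult)

lemma poly_quotient_prod:
  "(\<And>i. i \<in> I \<Longrightarrow> poly_quotient \<Theta> D (\<phi> i)) \<Longrightarrow> poly_quotient \<Theta> D (\<lambda>\<tau>. \<Prod>i\<in>I. \<phi> i \<tau>)"
  by (induction I rule: infinite_finite_induct) (simp_all add: poly_quotient_const poly_quotient_mult)

lemma poly_quotient_sum:
  "(\<And>i. i \<in> I \<Longrightarrow> poly_quotient \<Theta> D (\<phi> i)) \<Longrightarrow> poly_quotient \<Theta> D (\<lambda>\<tau>. \<Sum>i\<in>I. \<phi> i \<tau>)"
  by (induction I rule: infinite_finite_induct) (simp_all add: poly_quotient_const poly_quotient_add)

lemma unit_on_line:
  fixes F G :: "('c^'r::finite) set \<Rightarrow> 'c" and N :: "'k fls^'r \<Rightarrow> real"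
  assumes F: "rigid_holomorphic_on (Omega \<iota>) F" and G: "rigid_holomorphic_on (Omega \<iota>) G"
    and FG: "\<forall>P\<in>Omega \<iota>. F P * G P = 1"
    and "\<kappa> > 0" and \<kappa>: "\<And>v j. \<kappa> * absK (v $ j) \<le> N v"
  shows "\<exists>(n :: nat) a k p \<delta>. \<delta> > 0 \<and> (\<forall>i<n. a i \<noteq> 0) \<and>
    (\<forall>\<tau>. A + \<tau> *s B \<in> band N \<longrightarrow>
      absC (F (proj_pt (A + \<tau> *s B))) * (\<Prod>i<n. absC (lform (a i) (A + \<tau> *s B))) ^ k = absC (poly p \<tau>) \<and>
      \<delta> \<le> absC (poly p \<tau>))"
proof -
  fix l :: 'r
  obtain \<rho> \<epsilon> n a where *: "\<rho> \<noteq> 0 \<and> \<epsilon> \<noteq> 0 \<and> (\<forall>i<n. a i \<noteq> 0) \<and>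
    (\<forall>z\<in>rational_dom l \<rho> (Suc n) (form_prod n a) (form_num n a \<epsilon>). \<forall>v. lform v z = 0 \<longrightarrow> v = 0) \<and>
    (\<forall>y\<in>band N. inverse (y $ l) *s y \<in> rational_dom l \<rho> (Suc n) (form_prod n a) (form_num n a \<epsilon>))"
    using ex_rational_dom[where l = l, OF \<open>\<kappa> > 0\<close> \<kappa>] by (elim exE)
  define dom where "dom = rational_dom l \<rho> (Suc n) (form_prod n a) (form_num n a \<epsilon>)"
  from * have nz: "\<rho> \<noteq> 0" "\<epsilon> \<noteq> 0" and a: "\<And>i. i < n \<Longrightarrow> a i \<noteq> 0"
    and dom_Omega: "\<And>z v. z \<in> dom \<Longrightarrow> lform v z = 0 \<Longrightarrow> v = 0"
    and band_dom: "\<And>y. y \<in> band N \<Longrightarrow> inverse (y $ l) *s y \<in> dom"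
    unfolding dom_def[symmetric] by auto
  have Omega: "proj_pt z \<in> Omega \<iota>" if "z \<in> dom" for z
    using dom_Omega[OF that] by (intro mem_OmegaI)
  have data: "rational_data l \<rho> (Suc n) (form_prod n a) (form_num n a \<epsilon>)"
    using nz by (rule rational_data_forms)
  have affinoid: "affinoid_fun l \<rho> (Suc n) (form_prod n a) (form_num n a \<epsilon>) (\<lambda>z. H (proj_pt z))"
    if "rigid_holomorphic_on (Omega \<iota>) H" for H
    using that data Omega unfolding rigid_holomorphic_on_def dom_def by blast
  have FG_dom: "\<forall>z\<in>dom. F (proj_pt z) * G (proj_pt z) = 1"
    using FG Omega by blast
  obtain \<delta>0 c Y where *: "\<delta>0 > 0 \<and> finite Y \<and>
    (\<forall>z\<in>dom. \<delta>0 \<le> absC (F (proj_pt z)) \<and>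
      absC (F (proj_pt z)) = absC (\<Sum>\<alpha>\<in>Y. c \<alpha> * (\<Prod>i\<in>Inl ` (- {l}) \<union> Inr ` {..<Suc n}.
        case_sum (\<lambda>j z. z $ j / \<rho>) (\<lambda>i z. form_num n a \<epsilon> i z / form_prod n a z) i z ^ \<alpha> i)))"
    using unit_affinoid_fun_truncate[OF data affinoid[OF F] affinoid[OF G], folded dom_def, OF FG_dom]
    by (elim exE)
  note \<delta>0 = conjunct1[OF *] and F_dom = conjunct2[OF conjunct2[OF *], rule_format]
  define a' where "a' = a(n := axis l 1)"
  have a': "a' i \<noteq> 0" if "i < Suc n" for i
    using that a by (cases "i = n") (auto simp: a'_def axis_eq_0_iff)
  define y where "y = (\<lambda>\<tau>. A + \<tau> *s B)"
  define \<Theta> where "\<Theta> = {\<tau>. y \<tau> \<in> band N}"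
  define lp where "lp = (\<lambda>v. [:lform v A, lform v B:])"
  have lp: "poly (lp v) \<tau> = lform v (y \<tau>)" for v \<tau>
    by (simp add: lp_def y_def lform_add lform_scale mult.commute)
  define D where "D = (\<Prod>i<Suc n. lp (a' i))"
  have D: "poly D \<tau> = (\<Prod>i<Suc n. lform (a' i) (y \<tau>))" for \<tau>
    by (simp only: D_def poly_prod lp)
  have D_split: "poly D \<tau> = (\<Prod>i<n. lform (a i) (y \<tau>)) * y \<tau> $ l" for \<tau>
  proof -
    have "(\<Prod>i<n. lform (a' i) (y \<tau>)) = (\<Prod>i<n. lform (a i) (y \<tau>))"
      by (intro prod.cong) (auto simp: a'_def)
    then show ?thesis
      unfolding D by (simp add: a'_def lform_axis)
  qed
  have N_pos: "N v > 0" if "v \<noteq> 0" for v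
  proof -
    obtain j where "v $ j \<noteq> 0"
      using \<open>v \<noteq> 0\<close> by (auto simp: vec_eq_iff)
    then have "\<kappa> * absK (v $ j) > 0"
      using \<open>\<kappa> > 0\<close> absK_nonneg[of "v $ j"] by (simp add: less_le)
    then show ?thesis
      using \<kappa>[of v j] by linarith
  qed
  have lform_ge: "N v \<le> absC (lform v (y \<tau>))" if "\<tau> \<in> \<Theta>" for v \<tau>
    using that by (simp add: \<Theta>_def band_def)
  have lform_nz: "lform v (y \<tau>) \<noteq> 0" if "\<tau> \<in> \<Theta>" "v \<noteq> 0" for v \<tau>
    using lform_ge[OF that(1), of v] N_pos[OF that(2)] by auto
  have y_l: "y \<tau> $ l \<noteq> 0" if "\<tau> \<in> \<Theta>" for \<tau>
    using lform_nz[OF that, of "axis l 1"] by (simp add: lform_axis axis_eq_0_iff)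
  define z where "z = (\<lambda>\<tau>. inverse (y \<tau> $ l) *s y \<tau>)"
  have z_dom: "z \<tau> \<in> dom" if "\<tau> \<in> \<Theta>" for \<tau>
    using that band_dom by (simp add: z_def \<Theta>_def)
  have proj_z: "proj_pt (z \<tau>) = proj_pt (y \<tau>)" if "\<tau> \<in> \<Theta>" for \<tau>
    unfolding z_def using y_l[OF that] by (intro proj_pt_scale) simp
  have coord: "poly_quotient \<Theta> D (\<lambda>\<tau>. z \<tau> $ j / \<rho>)" for j
  proof (rule poly_quotientI)
    fix \<tau> assume "\<tau> \<in> \<Theta>"
    then show "z \<tau> $ j / \<rho> * poly D \<tau> ^ 1 = poly ([:inverse \<rho>:] * lp (axis j 1) * (\<Prod>i<n. lp (a i))) \<tau>"
      using y_l by (simp add: D_split z_def poly_prod lp lform_axis field_simps)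
  qed
  have quot: "poly_quotient \<Theta> D (\<lambda>\<tau>. \<epsilon> / lform (a i) (z \<tau>))" if i: "i < n" for i
  proof (rule poly_quotientI)
    fix \<tau> assume \<tau>: "\<tau> \<in> \<Theta>"
    have split: "(\<Prod>i<n. lform (a i) (y \<tau>)) = lform (a i) (y \<tau>) * (\<Prod>i'\<in>{..<n} - {i}. lform (a i') (y \<tau>))"
      using i by (intro prod.remove) auto
    show "\<epsilon> / lform (a i) (z \<tau>) * poly D \<tau> ^ 1 =
        poly ([:\<epsilon>:] * lp (axis l 1) ^ 2 * (\<Prod>i'\<in>{..<n} - {i}. lp (a i'))) \<tau>"
      unfolding D_split split using y_l[OF \<tau>] lform_nz[OF \<tau> a[OF i]]
      by (simp add: z_def lform_scale poly_prod lp lform_axis power2_eq_square field_simps)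
  qed
  have num: "poly_quotient \<Theta> D (\<lambda>\<tau>. form_num n a \<epsilon> i (z \<tau>) / form_prod n a (z \<tau>))" if i: "i < Suc n" for i
  proof -
    have "poly_quotient \<Theta> D (\<lambda>\<tau>. if i = n then \<Prod>i<n. \<epsilon> / lform (a i) (z \<tau>) else \<epsilon> / lform (a i) (z \<tau>))"
      using quot i by (cases "i = n") (auto intro!: poly_quotient_prod)
    moreover have "form_num n a \<epsilon> i (z \<tau>) / form_prod n a (z \<tau>) =
        (if i = n then \<Prod>i<n. \<epsilon> / lform (a i) (z \<tau>) else \<epsilon> / lform (a i) (z \<tau>))" if \<tau>: "\<tau> \<in> \<Theta>" for \<tau>
      using i by (rule form_num_divide) (use lform_nz[OF \<tau>] a y_l[OF \<tau>] in \<open>simp add: z_def lform_scale\<close>)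
    ultimately show ?thesis
      unfolding poly_quotient_def by simp
  qed
  have "poly_quotient \<Theta> D (\<lambda>\<tau>. \<Sum>\<alpha>\<in>Y. c \<alpha> * (\<Prod>i\<in>Inl ` (- {l}) \<union> Inr ` {..<Suc n}.
        case_sum (\<lambda>j z. z $ j / \<rho>) (\<lambda>i z. form_num n a \<epsilon> i z / form_prod n a z) i (z \<tau>) ^ \<alpha> i))"
    using coord num
    by (intro poly_quotient_sum poly_quotient_mult poly_quotient_const poly_quotient_prod poly_quotient_power) auto
  then obtain k p where p: "\<And>\<tau>. \<tau> \<in> \<Theta> \<Longrightarrow> (\<Sum>\<alpha>\<in>Y. c \<alpha> * (\<Prod>i\<in>Inl ` (- {l}) \<union> Inr ` {..<Suc n}.
        case_sum (\<lambda>j z. z $ j / \<rho>) (\<lambda>i z. form_num n a \<epsilon> i z / form_prod n a z) i (z \<tau>) ^ \<alpha> i)) *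
        poly D \<tau> ^ k = poly p \<tau>"
    unfolding poly_quotient_def by blast
  define \<delta> where "\<delta> = \<delta>0 * (\<Prod>i<Suc n. N (a' i)) ^ k"
  have prod_pos: "(\<Prod>i<Suc n. N (a' i)) > 0"
    using a' N_pos by (intro prod_pos) auto
  have "absC (F (proj_pt (y \<tau>))) * (\<Prod>i<Suc n. absC (lform (a' i) (y \<tau>))) ^ k = absC (poly p \<tau>) \<and>
      \<delta> \<le> absC (poly p \<tau>)" if \<tau>: "\<tau> \<in> \<Theta>" for \<tau>
  proof
    have 1: "absC (F (proj_pt (y \<tau>))) * absC (poly D \<tau>) ^ k = absC (poly p \<tau>)"
      unfolding p[OF \<tau>, symmetric] absC_mult absC_power proj_z[OF \<tau>, symmetric]
      using F_dom[OF z_dom[OF \<tau>]] by simp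
    then show eq: "absC (F (proj_pt (y \<tau>))) * (\<Prod>i<Suc n. absC (lform (a' i) (y \<tau>))) ^ k = absC (poly p \<tau>)"
      unfolding D absC_prod .
    have "(\<Prod>i<Suc n. N (a' i)) ^ k \<le> (\<Prod>i<Suc n. absC (lform (a' i) (y \<tau>))) ^ k"
      using prod_pos lform_ge[OF \<tau>] N_pos a'
      by (intro power_mono prod_mono) (auto simp: less_imp_le)
    moreover have "\<delta>0 \<le> absC (F (proj_pt (y \<tau>)))"
      using F_dom[OF z_dom[OF \<tau>]] proj_z[OF \<tau>] by simp
    ultimately show "\<delta> \<le> absC (poly p \<tau>)"
      unfolding eq[symmetric] \<delta>_def using \<delta>0 prod_pos by (intro mult_mono) (auto simp: less_imp_le)
  qed
  moreover have "\<delta> > 0"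
    using \<delta>0 prod_pos by (simp add: \<delta>_def)
  ultimately show ?thesis
    using a' unfolding \<Theta>_def y_def
    by (intro exI[of _ "Suc n"] exI[of _ a'] exI[of _ k] exI[of _ p] exI[of _ \<delta>]) simp
qed

section \<open>Fibres of the building map\<close>

lemma residually_independent_subset:
  assumes "residually_independent I \<eta>" "finite I" "I' \<subseteq> I"
  shows "residually_independent I' \<eta>"
proof -
  have "absC (\<Sum>i\<in>I'. const_emb (c i) * \<eta> i) = 1" if "\<exists>i\<in>I'. c i \<noteq> 0" for c
  proof -
    define c' where "c' = (\<lambda>i. if i \<in> I' then c i else 0)"
    have "\<exists>i\<in>I. c' i \<noteq> 0"
      using that \<open>I' \<subseteq> I\<close> by (auto simp: c'_def)
    then have "absC (\<Sum>i\<in>I. const_emb (c' i) * \<eta> i) = 1"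
      using assms(1) unfolding residually_independent_def by blast
    also have "(\<Sum>i\<in>I. const_emb (c' i) * \<eta> i) = (\<Sum>i\<in>I'. const_emb (c' i) * \<eta> i)"
      using assms(2,3) by (intro sum.mono_neutral_right) (auto simp: c'_def)
    also have "\<dots> = (\<Sum>i\<in>I'. const_emb (c i) * \<eta> i)"
      by (intro sum.cong) (auto simp: c'_def)
    finally show ?thesis .
  qed
  moreover have "absC (\<eta> i) \<le> 1" if "i \<in> I'" for i
    using assms(1,3) that unfolding residually_independent_def by blast
  ultimately show ?thesis
    unfolding residually_independent_def by simp
qed

lemma ex_orthogonal_points:
  fixes L :: "nat \<Rightarrow> ('k fls^'r::finite) set"
  assumes L: "\<And>i. i \<le> n \<Longrightarrow> is_lattice (L i)" and "D > 0"
  shows "\<exists>\<theta> y. \<theta> ^ D = emb fls_X \<and>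
    (\<forall>J\<subseteq>{..n}. \<forall>d v. J \<noteq> {} \<longrightarrow>
      (\<forall>i\<in>J. absC \<theta> ^ d i * lattice_norm (L i) v \<le> absC (lform v (\<Sum>i\<in>J. \<theta> ^ d i *s y i))) \<and>
      (\<exists>i\<in>J. absC (lform v (\<Sum>i\<in>J. \<theta> ^ d i *s y i)) = absC \<theta> ^ d i * lattice_norm (L i) v))"
proof -
  obtain x where x: "x ^ D = to_ac (fls_X :: 'k fls)"
    using nth_root_exists[OF \<open>D > 0\<close>] by blast
  define \<theta> where "\<theta> = \<iota> x"
  have \<theta>: "\<theta> ^ D = emb fls_X"
    by (simp only: \<theta>_def x flip: iota_power)
  define I where "I = {..n} \<times> (UNIV :: 'r set)"
  obtain \<eta> where \<eta>: "residually_independent I \<eta>"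
    using ex_residually_independent[of I] by (auto simp: I_def)
  have "\<forall>i. \<exists>B :: 'k fls^'r^'r. i \<le> n \<longrightarrow> (\<forall>v j. absK ((B *v v) $ j) \<le> lattice_norm (L i) v) \<and>
      (\<forall>v. \<exists>j. lattice_norm (L i) v = absK ((B *v v) $ j))"
    using lattice_norm_props[OF L] by blast
  then obtain B :: "nat \<Rightarrow> 'k fls^'r^'r" where B:
    "\<And>i v j. i \<le> n \<Longrightarrow> absK ((B i *v v) $ j) \<le> lattice_norm (L i) v"
    "\<And>i v. i \<le> n \<Longrightarrow> \<exists>j. lattice_norm (L i) v = absK ((B i *v v) $ j)"
    by metis
  define y :: "nat \<Rightarrow> 'c^'r" where "y = (\<lambda>i. \<chi> k. \<Sum>j\<in>UNIV. emb (B i $ j $ k) * \<eta> (i, j))"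
  have "(\<forall>i\<in>J. absC \<theta> ^ d i * lattice_norm (L i) v \<le> absC (lform v (\<Sum>i\<in>J. \<theta> ^ d i *s y i))) \<and>
      (\<exists>i\<in>J. absC (lform v (\<Sum>i\<in>J. \<theta> ^ d i *s y i)) = absC \<theta> ^ d i * lattice_norm (L i) v)"
    if J: "J \<subseteq> {..n}" "J \<noteq> {}" for J v and d :: "nat \<Rightarrow> nat"
  proof -
    define I' where "I' = J \<times> (UNIV :: 'r set)"
    have I': "finite I'" "I' \<noteq> {}" "I' \<subseteq> I"
      using J finite_subset[OF J(1)] by (auto simp: I'_def I_def)
    have \<eta>': "residually_independent I' \<eta>"
      using \<eta> _ I'(3) by (rule residually_independent_subset) (simp add: I_def)
    define e where "e = (\<lambda>(i, j :: 'r). d i)"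
    define a where "a = (\<lambda>(i, j). (B i *v v) $ j)"
    define S where "S = (\<Sum>k\<in>I'. \<theta> ^ e k * emb (a k) * \<eta> k)"
    have "lform v (\<Sum>i\<in>J. \<theta> ^ d i *s y i) = (\<Sum>i\<in>J. \<theta> ^ d i * lform v (y i))"
      by (simp add: lform_sum lform_scale)
    also have "\<dots> = (\<Sum>i\<in>J. \<Sum>j\<in>UNIV. \<theta> ^ d i * emb ((B i *v v) $ j) * \<eta> (i, j))"
      by (simp add: y_def lform_matrix sum_distrib_left mult.assoc)
    also have "\<dots> = S"
      by (simp add: S_def I'_def e_def a_def sum.cartesian_product case_prod_unfold)
    finally have S: "lform v (\<Sum>i\<in>J. \<theta> ^ d i *s y i) = S" .
    have abs_term: "absC (\<theta> ^ e (i, j) * emb (a (i, j))) = absC \<theta> ^ d i * absK ((B i *v v) $ j)" for i j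
      by (simp add: e_def a_def absC_mult absC_power absC_extends)
    have le_S: "absC \<theta> ^ d i * lattice_norm (L i) v \<le> absC S" if i: "i \<in> J" for i
    proof -
      have "i \<le> n"
        using J i by blast
      then obtain j where j: "lattice_norm (L i) v = absK ((B i *v v) $ j)"
        using B(2) by blast
      have "(i, j) \<in> I'"
        using i by (simp add: I'_def)
      then show ?thesis
        using absC_sum_residually_independent(2)[OF \<open>D > 0\<close> \<theta> I'(1,2) \<eta>', of "(i, j)" e a]
        unfolding S_def[symmetric] abs_term j by blast
    qed
    moreover have "\<exists>i\<in>J. absC S = absC \<theta> ^ d i * lattice_norm (L i) v"
    proof -
      obtain k where k: "k \<in> I'" "absC S = absC (\<theta> ^ e k * emb (a k))"
        using absC_sum_residually_independent(1)[OF \<open>D > 0\<close> \<theta> I'(1,2) \<eta>', of e a]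
        unfolding S_def[symmetric] by blast
      obtain i j where ij: "k = (i, j)"
        by (cases k)
      have i: "i \<in> J" "i \<le> n"
        using k(1) J by (auto simp: I'_def ij)
      have "absC S \<le> absC \<theta> ^ d i * lattice_norm (L i) v"
        unfolding k(2) ij abs_term using B(1)[OF i(2)] by (intro mult_left_mono) auto
      with le_S[OF i(1)] show ?thesis
        using i(1) by (intro bexI[of _ i]) auto
    qed
    ultimately show ?thesis
      unfolding S by blast
  qed
  then show ?thesis
    using \<theta> by (intro exI[of _ \<theta>] exI[of _ y]) simp
qed

lemma absC_const_on_fibre:
  fixes F G :: "('c^'r::finite) set \<Rightarrow> 'c" and N :: "'k fls^'r \<Rightarrow> real"
  assumes F: "rigid_holomorphic_on (Omega \<iota>) F" and G: "rigid_holomorphic_on (Omega \<iota>) G"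
    and FG: "\<forall>P\<in>Omega \<iota>. F P * G P = 1"
    and "\<kappa> > 0" and \<kappa>: "\<And>v j. \<kappa> * absK (v $ j) \<le> N v"
    and y: "y \<in> band N" and eq: "\<And>v. absC (lform v y') = absC (lform v y)"
  shows "absC (F (proj_pt y')) = absC (F (proj_pt y))"
proof -
  define B where "B = y' + (- 1) *s y"
  have lform_B: "lform v B = lform v y' - lform v y" for v
    by (simp only: B_def lform_add lform_scale) simp
  obtain n a k p \<delta> where *: "\<delta> > 0 \<and> (\<forall>i<(n :: nat). a i \<noteq> 0) \<and>
    (\<forall>\<tau>. y + \<tau> *s B \<in> band N \<longrightarrow>
      absC (F (proj_pt (y + \<tau> *s B))) * (\<Prod>i<n. absC (lform (a i) (y + \<tau> *s B))) ^ k = absC (poly p \<tau>) \<and>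
      \<delta> \<le> absC (poly p \<tau>))"
    using unit_on_line[OF F G FG \<open>\<kappa> > 0\<close> \<kappa>, of y B] by (elim exE)
  have lform_y: "lform v (y + \<tau> *s B) = lform v y + \<tau> * lform v B" for v \<tau>
    by (simp add: lform_add lform_scale)
  have B_le: "absC (lform v B) \<le> absC (lform v y)" for v
    unfolding lform_B using absC_diff_ultrametric[of "lform v y'" "lform v y"] by (simp add: eq)
  have small: "absC (u + \<tau> * lform v B) = absC (lform v y)"
    if "absC u = absC (lform v y)" "absC \<tau> < 1" for u \<tau> v
  proof (cases "lform v B = 0")
    case False
    then have "absC (\<tau> * lform v B) < absC (lform v B)"
      using that(2) by (simp add: absC_mult)
    also have "\<dots> \<le> absC u"
      using B_le that(1) by simp
    finally show ?thesis
      using that(1) by (simp add: absC_add_eq_left)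
  qed (use that in simp)
  have band: "y + \<tau> *s B \<in> band N" if "absC \<tau> < 1 \<or> absC (\<tau> - 1) < 1" for \<tau>
  proof -
    have "absC (lform v (y + \<tau> *s B)) = absC (lform v y)" for v
      using that
    proof
      assume "absC \<tau> < 1"
      then show ?thesis
        unfolding lform_y by (intro small) simp_all
    next
      assume "absC (\<tau> - 1) < 1"
      moreover have "lform v y + \<tau> * lform v B = lform v y' + (\<tau> - 1) * lform v B"
        by (simp add: lform_B algebra_simps)
      ultimately show ?thesis
        unfolding lform_y by (simp add: small eq)
    qed
    then show ?thesis
      using y by (simp add: band_def)
  qed
  have "absC (poly p 0) = absC (poly p 1)"
    using conjunct1[OF *] by (rule absC_poly_0_eq_1) (use * band in blast)
  moreover have "y + \<tau> *s B \<in> band N \<Longrightarrow> absC (F (proj_pt (y + \<tau> *s B))) *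
      (\<Prod>i<n. absC (lform (a i) (y + \<tau> *s B))) ^ k = absC (poly p \<tau>)" for \<tau>
    using * by blast
  note this[of 0, OF band[of 0]] this[of 1, OF band[of 1]]
  moreover have "y + 0 *s B = y" "y + 1 *s B = y'"
    by (simp_all add: B_def)
  ultimately have eq': "absC (F (proj_pt y)) * (\<Prod>i<n. absC (lform (a i) y)) ^ k =
      absC (F (proj_pt y')) * (\<Prod>i<n. absC (lform (a i) y)) ^ k"
    by (simp only: eq diff_self absC_0 zero_less_one simp_thms)
  have "(\<Prod>i<n. absC (lform (a i) y)) > 0"
  proof (rule prod_pos)
    fix i assume "i \<in> {..<n}"
    then have "a i \<noteq> 0"
      using * by blast
    then obtain j where "a i $ j \<noteq> 0"
      by (auto simp: vec_eq_iff)
    then have "\<kappa> * absK (a i $ j) > 0"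
      using \<open>\<kappa> > 0\<close> absK_nonneg[of "a i $ j"] by (simp add: less_le)
    also have "\<dots> \<le> N (a i)"
      by (rule \<kappa>)
    also have "\<dots> \<le> absC (lform (a i) y)"
      using y by (simp add: band_def)
    finally show "absC (lform (a i) y) > 0" .
  qed
  then have "(\<Prod>i<n. absC (lform (a i) y)) ^ k \<noteq> 0"
    by (rule less_imp_neq[OF zero_less_power, THEN not_sym])
  with eq' show ?thesis
    by (metis mult_right_cancel)
qed

lemma homothety_class_scale:
  assumes "c > 0"
  shows "homothety_class (\<lambda>v. c * N v) = homothety_class N"
proof
  show "homothety_class (\<lambda>v. c * N v) \<subseteq> homothety_class N"
  proof
    fix M assume "M \<in> homothety_class (\<lambda>v. c * N v)"
    then obtain s where "s > 0" "M = (\<lambda>v. s * (c * N v))"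
      unfolding homothety_class_def by blast
    then have "M = (\<lambda>v. (s * c) * N v)" "s * c > 0"
      using assms by (simp_all add: mult.assoc)
    then show "M \<in> homothety_class N"
      unfolding homothety_class_def by blast
  qed
  show "homothety_class N \<subseteq> homothety_class (\<lambda>v. c * N v)"
  proof
    fix M assume "M \<in> homothety_class N"
    then obtain s where "s > 0" "M = (\<lambda>v. s * N v)"
      unfolding homothety_class_def by blast
    then have "M = (\<lambda>v. (s / c) * (c * N v))" "s / c > 0"
      using assms by simp_all
    then show "M \<in> homothety_class (\<lambda>v. c * N v)"
      unfolding homothety_class_def by blast
  qed
qed

lemma building_map_proj_pt: "building_map \<iota> (proj_pt y) = homothety_class (\<lambda>v. absC (lform v y))"
proof -
  have "homothety_class (\<lambda>v. absC (lform v w)) = homothety_class (\<lambda>v. absC (lform v y))"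
    if "w \<in> proj_pt y" for w
    using that by (auto simp: proj_pt_def lform_scale absC_mult homothety_class_scale)
  then have "building_map \<iota> (proj_pt y) = (\<Union>w\<in>proj_pt y. homothety_class (\<lambda>v. absC (lform v y)))"
    by (simp add: building_map_def)
  moreover have "y \<in> proj_pt y"
    unfolding proj_pt_def by (auto intro: exI[of _ 1])
  ultimately show ?thesis
    by auto
qed

lemma log_on_building_eq:
  fixes F G :: "('c^'r::finite) set \<Rightarrow> 'c" and N :: "'k fls^'r \<Rightarrow> real"
  assumes F: "rigid_holomorphic_on (Omega \<iota>) F" and G: "rigid_holomorphic_on (Omega \<iota>) G"
    and FG: "\<forall>P\<in>Omega \<iota>. F P * G P = 1"
    and "\<kappa> > 0" and \<kappa>: "\<And>v j. \<kappa> * absK (v $ j) \<le> N v"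
    and y: "y \<in> band N" "proj_pt y \<in> Omega \<iota>"
  shows "log_on_building \<iota> F (homothety_class (\<lambda>v. absC (lform v y))) = log q (absC (F (proj_pt y)))"
  unfolding log_on_building_def q_eq[symmetric]
proof (rule the_equality)
  show "\<forall>P\<in>Omega \<iota>. building_map \<iota> P = homothety_class (\<lambda>v. absC (lform v y)) \<longrightarrow>
      log q (absC (F P)) = log q (absC (F (proj_pt y)))"
  proof (intro ballI impI)
    fix P assume P: "P \<in> Omega \<iota>" and eq: "building_map \<iota> P = homothety_class (\<lambda>v. absC (lform v y))"
    obtain w where w: "P = proj_pt w"
      using P by (auto simp: Omega_def)
    have "(\<lambda>v. absC (lform v w)) \<in> homothety_class (\<lambda>v. absC (lform v w))"
      unfolding homothety_class_def by (auto intro: exI[of _ 1])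
    also have "\<dots> = homothety_class (\<lambda>v. absC (lform v y))"
      using eq unfolding w building_map_proj_pt .
    finally obtain s where s: "s > 0" "(\<lambda>v. absC (lform v w)) = (\<lambda>v. s * absC (lform v y))"
      unfolding homothety_class_def by blast
    fix l :: 'r
    define v0 :: "'k fls^'r" where "v0 = axis l 1"
    have "N v0 \<ge> \<kappa>"
      using \<kappa>[of v0 l] by (simp add: v0_def)
    moreover have "absC (lform v0 y) \<ge> N v0"
      using y(1) by (simp add: band_def)
    ultimately have v0: "absC (lform v0 y) > 0"
      using \<open>\<kappa> > 0\<close> by linarith
    define c where "c = lform v0 y / lform v0 w"
    have w_v0: "absC (lform v0 w) = s * absC (lform v0 y)"
      using s(2) by (rule fun_cong)
    have c: "absC c = inverse s"
      unfolding c_def absC_divide w_v0 using v0 s(1) by (simp add: field_simps)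
    then have "c \<noteq> 0"
      using s(1) by auto
    have "absC (lform v (c *s w)) = absC (lform v y)" for v
      using fun_cong[OF s(2), of v] s(1) by (simp add: lform_scale absC_mult c)
    with y(1) have "absC (F (proj_pt (c *s w))) = absC (F (proj_pt y))"
      by (rule absC_const_on_fibre[OF F G FG \<open>\<kappa> > 0\<close> \<kappa>])
    then show "log q (absC (F P)) = log q (absC (F (proj_pt y)))"
      unfolding w proj_pt_scale[OF \<open>c \<noteq> 0\<close>] by simp
  qed
next
  fix x
  assume "\<forall>P\<in>Omega \<iota>. building_map \<iota> P = homothety_class (\<lambda>v. absC (lform v y)) \<longrightarrow> log q (absC (F P)) = x"
  from bspec[OF this y(2)] show "x = log q (absC (F (proj_pt y)))"
    by (simp add: building_map_proj_pt)
qed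

end

section \<open>Points above a simplex\<close>

definition partial_sum :: "(nat \<Rightarrow> nat) \<Rightarrow> nat \<Rightarrow> nat" where
  "partial_sum s i = (\<Sum>j<i. s j)"

lemma partial_sum_shift:
  assumes "a < b" "x + z = s a + s b"
  shows "partial_sum (s(a := x, b := z)) i + (if a < i \<and> i \<le> b then s a else 0) =
    partial_sum s i + (if a < i \<and> i \<le> b then x else 0)"
  unfolding partial_sum_def using assms by (induction i) (auto split: if_splits)

lemma max_of_unit_slopes:
  fixes M :: "nat \<Rightarrow> int" and s :: "nat \<Rightarrow> nat"
  assumes mono: "\<And>i j. i \<le> j \<Longrightarrow> j \<le> n \<Longrightarrow> M i \<le> M j" and last: "M n \<le> M 0 + 1"
  defines "D \<equiv> \<Sum>i\<le>n. s i"
  shows "i \<le> n \<Longrightarrow> int D * M i - int (partial_sum s i) \<le> (\<Sum>j\<le>n. int (s j) * M j)"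
    and "\<exists>i\<le>n. int D * M i - int (partial_sum s i) = (\<Sum>j\<le>n. int (s j) * M j)"
proof -
  have split: "int D * M i - int (partial_sum s i) = (\<Sum>j\<le>n. int (s j) * (if j < i then M i - 1 else M i))"
    if "i \<le> n" for i
  proof -
    have "(\<Sum>j\<le>n. int (s j) * (if j < i then M i - 1 else M i)) =
        (\<Sum>j\<le>n. int (s j) * M i) - (\<Sum>j\<le>n. if j < i then int (s j) else 0)"
      unfolding sum_subtractf[symmetric] by (intro sum.cong) (auto simp: algebra_simps)
    also have "(\<Sum>j\<le>n. if j < i then int (s j) else 0) = (\<Sum>j<i. int (s j))"
      using that by (intro sum.mono_neutral_cong_right) auto
    finally show ?thesis
      by (simp add: D_def partial_sum_def sum_distrib_right)
  qed
  show "int D * M i - int (partial_sum s i) \<le> (\<Sum>j\<le>n. int (s j) * M j)" if i: "i \<le> n" for i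
    unfolding split[OF i]
  proof (intro sum_mono mult_left_mono)
    fix j assume "j \<in> {..n}"
    moreover have "M i \<le> M n" "M 0 \<le> M j"
      using mono i \<open>j \<in> {..n}\<close> by auto
    ultimately show "(if j < i then M i - 1 else M i) \<le> M j"
      using mono[of i j] last by auto
  qed simp
  define i where "i = (if M n = M 0 then 0 else LEAST i. M i = M n)"
  have i: "i \<le> n" and M_eq: "(if j < i then M i - 1 else M i) = M j" if "j \<le> n" for j
  proof -
    show "i \<le> n"
      by (auto simp: i_def intro: Least_le)
    show "(if j < i then M i - 1 else M i) = M j"
    proof (cases "M n = M 0")
      case True
      then show ?thesis
        using mono[of 0 j] mono[of j n] that by (simp add: i_def)
    next
      case False
      then have M_n: "M n = M 0 + 1"
        using last mono[of 0 n] by auto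
      have "M i = M n"
        using False by (simp add: i_def) (rule LeastI[of _ n], rule refl)
      moreover have "M j \<noteq> M n" if "j < i"
        using that False not_less_Least by (simp add: i_def)
      ultimately show ?thesis
        using mono[of 0 j] mono[of j n] mono[of i j] that M_n by auto
    qed
  qed
  have "int D * M i - int (partial_sum s i) = (\<Sum>j\<le>n. int (s j) * M j)"
    unfolding split[OF i[OF order_refl]] using M_eq by (intro sum.cong) auto
  then show "\<exists>i\<le>n. int D * M i - int (partial_sum s i) = (\<Sum>j\<le>n. int (s j) * M j)"
    using i by blast
qed

locale lattice_chain_points = C_infinity \<iota>
  for \<iota> :: "'k::{field,finite} fls alg_closure \<Rightarrow> 'c::{field,complete_space}" +
  fixes L :: "nat \<Rightarrow> ('k fls^'r::finite) set" and n D :: nat and \<theta> :: 'c and y :: "nat \<Rightarrow> 'c^'r"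
  assumes lattice: "i \<le> n \<Longrightarrow> is_lattice (L i)"
    and chain: "i < n \<Longrightarrow> L (Suc i) \<subseteq> L i"
    and wrap: "(*s) fls_X ` L 0 \<subseteq> L n"
    and D: "D > 0" and \<theta>: "\<theta> ^ D = \<iota> (to_ac fls_X)"
    and orthogonal: "J \<subseteq> {..n} \<Longrightarrow> i \<in> J \<Longrightarrow>
      absC \<theta> ^ d i * lattice_norm (L i) v \<le> absC (lin_form \<iota> v (\<Sum>i\<in>J. \<theta> ^ d i *s y i))"
    and attained: "J \<subseteq> {..n} \<Longrightarrow> J \<noteq> {} \<Longrightarrow>
      \<exists>i\<in>J. absC (lin_form \<iota> v (\<Sum>i\<in>J. \<theta> ^ d i *s y i)) = absC \<theta> ^ d i * lattice_norm (L i) v"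
begin

abbreviation N :: "nat \<Rightarrow> 'k fls^'r \<Rightarrow> real" where "N i \<equiv> lattice_norm (L i)"

definition pt :: "(nat \<Rightarrow> nat) \<Rightarrow> 'c^'r" where
  "pt s = (\<Sum>i\<le>n. \<theta> ^ partial_sum s i *s y i)"

lemma N_mono: "i \<le> j \<Longrightarrow> j \<le> n \<Longrightarrow> N i v \<le> N j v"
proof (induction j rule: dec_induct)
  case (step j)
  have "N j v \<le> N (Suc j) v"
    using step by (intro lattice_norm_antimono lattice chain) auto
  with step show ?case
    by simp
qed simp

lemma N_last: "N n v \<le> q * N 0 v"
  by (intro lattice_norm_fls_X lattice wrap) auto

lemma N_pos: "i \<le> n \<Longrightarrow> v \<noteq> 0 \<Longrightarrow> N i v > 0"
  by (intro lattice_norm_pos lattice)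

lemma absC_\<theta>: "absC \<theta> = q powr (- 1 / D)"
proof -
  have "absC \<theta> ^ D = q powr - 1"
    using \<theta> by (simp add: powr_minus absC_extends flip: absC_power)
  also have "\<dots> = (q powr (- 1 / D)) ^ D"
    using D by (simp add: powr_power)
  finally show ?thesis
    using D by (auto intro: power_eq_imp_eq_base)
qed

lemma \<theta>_nonzero: "\<theta> \<noteq> 0"
  using absC_\<theta> by (metis absC_0 powr_gt_zero less_irrefl q_pos)

lemma absC_\<theta>_power: "absC \<theta> ^ m = q powr (- real m / D)"
  unfolding absC_\<theta> by (simp add: powr_power)

lemma absC_\<theta>_le_1: "absC \<theta> \<le> 1"
  unfolding absC_\<theta> using powr_mono[of "- 1 / D" 0 q] by simp

lemma pt_band: "pt s \<in> band (N 0)"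
proof -
  have "N 0 v \<le> absC (lform v (pt s))" for v
    using orthogonal[of "{..n}" 0 "partial_sum s" v] by (simp add: pt_def partial_sum_def)
  moreover have "absC (lform v (pt s)) \<le> q * N 0 v" for v
  proof -
    obtain i where i: "i \<le> n" "absC (lform v (pt s)) = absC \<theta> ^ partial_sum s i * N i v"
      using attained[of "{..n}" v "partial_sum s"] by (auto simp: pt_def)
    have "absC \<theta> ^ partial_sum s i \<le> 1"
      using absC_\<theta>_le_1 by (intro power_le_one) auto
    then have "absC (lform v (pt s)) \<le> N i v"
      unfolding i(2) using lattice_norm_nonneg[OF lattice[OF i(1)]] by (intro mult_left_le_one_le) auto
    also have "\<dots> \<le> q * N 0 v"
      using N_mono[OF i(1) order_refl] N_last by (rule order_trans)
    finally show ?thesis .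
  qed
  ultimately show ?thesis
    by (simp add: band_def)
qed

lemma absC_lform_pt:
  assumes s: "(\<Sum>i\<le>n. s i) = D"
  shows "absC (lform v (pt s)) = (\<Prod>i\<le>n. N i v powr (s i / D))"
proof (cases "v = 0")
  case True
  have "N 0 v = 0"
    using lattice[of 0] True by simp
  then have "(\<Prod>i\<le>n. N i v powr (s i / D)) = 0"
    by (intro prod_zero) auto
  then show ?thesis
    using True by simp
next
  case False
  have "\<forall>i. \<exists>m. i \<le> n \<longrightarrow> N i v = q powi m"
    using lattice_norm_powi[OF lattice False] by blast
  then obtain M where "\<And>i. i \<le> n \<Longrightarrow> N i v = q powi M i"
    by metis
  then have M: "N i v = q powr M i" if "i \<le> n" for i
    using that powr_real_of_int'[of q "M i"] by simp
  have mono: "M i \<le> M j" if "i \<le> j" "j \<le> n" for i j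
  proof -
    have "q powr M i \<le> q powr M j"
      using N_mono[OF that, of v] that by (simp only: M order_trans[OF that])
    then show ?thesis
      using q_gt_1 by simp
  qed
  have last: "M n \<le> M 0 + 1"
  proof -
    have "q powr M n \<le> q powr (1 + M 0)"
      using N_last[of v] unfolding M[OF order_refl] M[OF le0] by (simp add: powr_add)
    then show ?thesis
      using q_gt_1 by simp
  qed
  define E where "E = (\<Sum>j\<le>n. int (s j) * M j)"
  have D_sum: "int D * M i - int (partial_sum s i) \<le> E" if "i \<le> n" for i
    using max_of_unit_slopes(1)[of n M i s] mono last that s by (simp add: E_def)
  have attain: "\<exists>i\<le>n. int D * M i - int (partial_sum s i) = E"
    using max_of_unit_slopes(2)[of n M s] mono last s by (simp add: E_def)
  have summand: "absC \<theta> ^ partial_sum s i * N i v = q powr (of_int (int D * M i - int (partial_sum s i)) / D)"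
    if "i \<le> n" for i
    unfolding absC_\<theta>_power M[OF that] powr_add[symmetric] using D by (simp add: field_simps)
  have "(\<Prod>i\<le>n. N i v powr (s i / D)) = (\<Prod>i\<le>n. q powr (M i * (s i / D)))"
    by (intro prod.cong) (simp_all add: M powr_powr)
  also have "\<dots> = q powr (\<Sum>i\<le>n. M i * (s i / D))"
    by (rule powr_sum[symmetric]) simp_all
  also have "(\<Sum>i\<le>n. M i * (s i / D)) = of_int E / D"
    by (simp add: E_def sum_divide_distrib mult.commute)
  finally have rhs: "(\<Prod>i\<le>n. N i v powr (s i / D)) = q powr (of_int E / D)" .
  show ?thesis
    unfolding rhs
  proof (rule antisym)
    obtain i where i: "i \<le> n" "absC (lform v (pt s)) = absC \<theta> ^ partial_sum s i * N i v"
      using attained[of "{..n}" v "partial_sum s"] by (auto simp: pt_def)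
    show "absC (lform v (pt s)) \<le> q powr (of_int E / D)"
      unfolding i(2) summand[OF i(1)]
      by (intro powr_mono divide_right_mono) (use D_sum[OF i(1)] in \<open>simp_all only: of_int_le_iff of_nat_0_le_iff q_ge_1\<close>)
  next
    obtain i where i: "i \<le> n" "int D * M i - int (partial_sum s i) = E"
      using attain by blast
    show "q powr (of_int E / D) \<le> absC (lform v (pt s))"
      unfolding i(2)[symmetric] summand[OF i(1), symmetric]
      using orthogonal[of "{..n}" i "partial_sum s" v] i(1) by (simp add: pt_def)
  qed
qed

lemma absC_lform_sub:
  assumes "J \<subseteq> {..n}" "J \<noteq> {}"
  shows "absC (lform v (\<Sum>i\<in>J. \<theta> ^ partial_sum s i *s y i)) \<le> absC (lform v (pt s))"
proof -
  obtain i where i: "i \<in> J"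
    "absC (lform v (\<Sum>i\<in>J. \<theta> ^ partial_sum s i *s y i)) = absC \<theta> ^ partial_sum s i * N i v"
    using attained[OF assms] by blast
  then show ?thesis
    using orthogonal[of "{..n}" i "partial_sum s" v] assms(1) by (auto simp: pt_def)
qed

lemma pt_nonzero:
  assumes "lform v (pt s) = 0"
  shows "v = 0"
proof (rule ccontr)
  assume "v \<noteq> 0"
  then have "N 0 v > 0"
    by (intro N_pos) simp_all
  moreover have "N 0 v \<le> absC (lform v (pt s))"
    using pt_band[of s] by (simp add: band_def)
  ultimately show False
    using assms by simp
qed

lemma pt_Omega: "proj_pt (pt s) \<in> Omega \<iota>"
  using pt_nonzero by (rule mem_OmegaI)

lemma pt_shift:
  fixes s :: "nat \<Rightarrow> nat"
  assumes "a < b" "b \<le> n"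
  defines "J \<equiv> {a<..b}"
  defines "A \<equiv> (\<Sum>i\<in>{..n} - J. \<theta> ^ partial_sum s i *s y i)"
    and "B \<equiv> (\<Sum>i\<in>J. \<theta> ^ partial_sum (s(a := 0, b := s a + s b)) i *s y i)"
  assumes xz: "x + z = s a + s b"
  shows "pt (s(a := x, b := z)) = A + \<theta> ^ x *s B"
    and "\<theta> ^ x *s B = (\<Sum>i\<in>J. \<theta> ^ partial_sum (s(a := x, b := z)) i *s y i)"
proof -
  let ?u = "s(a := 0, b := s a + s b)" and ?s = "s(a := x, b := z)"
  have in_J: "partial_sum ?s i = partial_sum ?u i + x" if "i \<in> J" for i
  proof -
    have "partial_sum ?s i + s a = partial_sum s i + x"
      using partial_sum_shift[OF \<open>a < b\<close> xz, of i] that by (simp add: J_def)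
    moreover have "partial_sum ?u i + s a = partial_sum s i"
      using partial_sum_shift[of a b 0 "s a + s b" s i] \<open>a < b\<close> that by (simp add: J_def)
    ultimately show ?thesis
      by linarith
  qed
  have not_J: "partial_sum ?s i = partial_sum s i" if "i \<notin> J" for i
    using partial_sum_shift[OF \<open>a < b\<close> xz, of i] that unfolding J_def greaterThanAtMost_iff
    by (simp only: if_False add_0_right)
  have smult_sum: "c *s (\<Sum>i\<in>I. g i) = (\<Sum>i\<in>I. c *s g i)" for c :: 'c and I :: "nat set" and g :: "nat \<Rightarrow> 'c^'r"
    by (simp add: vec_eq_iff sum_distrib_left)
  show B: "\<theta> ^ x *s B = (\<Sum>i\<in>J. \<theta> ^ partial_sum ?s i *s y i)"
    unfolding B_def smult_sum by (intro sum.cong) (simp_all add: in_J vector_smult_assoc power_add mult.commute)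
  have "pt ?s = (\<Sum>i\<in>{..n} - J. \<theta> ^ partial_sum ?s i *s y i) + (\<Sum>i\<in>J. \<theta> ^ partial_sum ?s i *s y i)"
    unfolding pt_def using assms(2) by (intro sum.subset_diff) (auto simp: J_def)
  also have "(\<Sum>i\<in>{..n} - J. \<theta> ^ partial_sum ?s i *s y i) = A"
    unfolding A_def by (intro sum.cong) (simp_all add: not_J)
  finally show "pt ?s = A + \<theta> ^ x *s B"
    unfolding B .
qed

definition weighted :: "(nat \<Rightarrow> nat) \<Rightarrow> (nat \<Rightarrow> real) \<Rightarrow> real" where
  "weighted s g = (\<Sum>i\<le>n. s i / D * g i)"

lemma weighted_shift:
  fixes s :: "nat \<Rightarrow> nat"
  assumes "a \<noteq> b"
  shows "(real (s a) + real (s b)) * weighted s g =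
    s b * weighted (s(a := 0, b := s a + s b)) g + s a * weighted (s(a := s a + s b, b := 0)) g"
proof -
  have "(real (s a) + real (s b)) * real (s i) =
      s b * real ((s(a := 0, b := s a + s b)) i) + s a * real ((s(a := s a + s b, b := 0)) i)" for i
    using assms by (auto simp: algebra_simps)
  then have "(real (s a) + real (s b)) * (s i / D * g i) =
      s b * ((s(a := 0, b := s a + s b)) i / D * g i) + s a * ((s(a := s a + s b, b := 0)) i / D * g i)" for i
    unfolding mult.assoc[symmetric] times_divide_eq_right distrib_right[symmetric] add_divide_distrib[symmetric]
    by presburger
  then show ?thesis
    unfolding weighted_def sum_distrib_left sum.distrib[symmetric] by simp
qed

lemma sum_shift:
  fixes s :: "nat \<Rightarrow> nat"
  assumes "a < b" "b \<le> n" "x + z = s a + s b"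
  shows "(\<Sum>i\<le>n. (s(a := x, b := z)) i) = (\<Sum>i\<le>n. s i)"
proof -
  have split: "(\<Sum>i\<le>n. g i) = g a + (g b + (\<Sum>i\<in>{..n} - {a} - {b}. g i))" for g :: "nat \<Rightarrow> nat"
    using assms by (simp add: sum.remove[of "{..n}" a] sum.remove[of "{..n} - {a}" b])
  have "(\<Sum>i\<in>{..n} - {a} - {b}. (s(a := x, b := z)) i) = (\<Sum>i\<in>{..n} - {a} - {b}. s i)"
    by (intro sum.cong) auto
  then show ?thesis
    using assms split[of s] split[of "s(a := x, b := z)"] by simp
qed

lemma log_absC_lform_pt:
  assumes "(\<Sum>i\<le>n. s i) = D" "v \<noteq> 0"
  shows "log q (absC (lform v (pt s))) = weighted s (\<lambda>i. log q (N i v))"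
proof -
  have "N i v powr (s i / D) \<noteq> 0" if "i \<le> n" for i
    using N_pos[OF that assms(2)] by simp
  then have "log q (absC (lform v (pt s))) = (\<Sum>i\<le>n. log q (N i v powr (s i / D)))"
    unfolding absC_lform_pt[OF assms(1)] log_def sum_divide_distrib[symmetric] by (subst ln_prod) auto
  also have "\<dots> = weighted s (\<lambda>i. log q (N i v))"
    unfolding weighted_def by (intro sum.cong) (simp_all add: log_powr)
  finally show ?thesis .
qed

section \<open>Logarithms of units\<close>

lemma ex_lower_bound: "\<exists>\<kappa>>0. \<forall>v j. \<kappa> * absK (v $ j) \<le> N 0 v"
  by (intro lattice_norm_lower_bound lattice) simp

definition log_at :: "(('c^'r) set \<Rightarrow> 'c) \<Rightarrow> (nat \<Rightarrow> nat) \<Rightarrow> real" where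
  "log_at F s = log q (absC (F (proj_pt (pt s))))"

context
  fixes F G :: "('c^'r) set \<Rightarrow> 'c"
  assumes F: "rigid_holomorphic_on (Omega \<iota>) F" and G: "rigid_holomorphic_on (Omega \<iota>) G"
    and FG: "\<forall>P\<in>Omega \<iota>. F P * G P = 1"
begin

lemma log_at_convex:
  assumes ab: "a < b" "b \<le> n" and s: "(\<Sum>i\<le>n. s i) = D"
  shows "(real (s a) + real (s b)) * log_at F s \<le>
    s b * log_at F (s(a := 0, b := s a + s b)) + s a * log_at F (s(a := s a + s b, b := 0))"
proof -
  define J where "J = {a<..b}"
  have J: "J \<subseteq> {..n}" "J \<noteq> {}"
    using ab by (auto simp: J_def)
  define A where "A = (\<Sum>i\<in>{..n} - J. \<theta> ^ partial_sum s i *s y i)"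
  define B where "B = (\<Sum>i\<in>J. \<theta> ^ partial_sum (s(a := 0, b := s a + s b)) i *s y i)"
  note pt_eq = pt_shift(1)[OF ab, of _ _ s, folded J_def, folded A_def B_def]
  note B_eq = pt_shift(2)[OF ab, of _ _ s, folded J_def, folded B_def]
  obtain \<kappa> where \<kappa>: "\<kappa> > 0" "\<And>v j. \<kappa> * absK (v $ j) \<le> N 0 v"
    using ex_lower_bound by blast
  obtain m c k p \<delta> where *: "\<delta> > 0 \<and> (\<forall>i<(m :: nat). c i \<noteq> 0) \<and>
    (\<forall>\<tau>. A + \<tau> *s B \<in> band (N 0) \<longrightarrow>
      absC (F (proj_pt (A + \<tau> *s B))) * (\<Prod>i<m. absC (lform (c i) (A + \<tau> *s B))) ^ k = absC (poly p \<tau>) \<and>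
      \<delta> \<le> absC (poly p \<tau>))"
    using unit_on_line[OF F G FG \<kappa>, of A B] by (elim exE)
  have p_lower: "\<delta> \<le> absC (poly p \<tau>)" if "absC (\<tau> - \<theta> ^ x) < absC (\<theta> ^ x)" "x + z = s a + s b" for \<tau> x z
  proof -
    define s' where "s' = s(a := x, b := z)"
    have pt': "A + \<theta> ^ x *s B = pt s'"
      unfolding s'_def by (rule pt_eq[OF that(2), symmetric])
    have "absC (lform v (A + \<tau> *s B)) = absC (lform v (pt s'))" for v
    proof -
      have "lform v (A + \<tau> *s B) = lform v (A + \<theta> ^ x *s B) + (\<tau> - \<theta> ^ x) * lform v B"
        by (simp add: lform_add lform_scale algebra_simps)
      then have eq: "lform v (A + \<tau> *s B) = lform v (pt s') + (\<tau> - \<theta> ^ x) * lform v B"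
        unfolding pt' .
      show ?thesis
      proof (cases "lform v B = 0")
        case False
        then have "absC ((\<tau> - \<theta> ^ x) * lform v B) < absC (\<theta> ^ x) * absC (lform v B)"
          using that(1) by (simp add: absC_mult)
        also have "\<dots> = absC (lform v (\<theta> ^ x *s B))"
          by (simp add: lform_scale absC_mult)
        also have "\<dots> \<le> absC (lform v (pt s'))"
          unfolding B_eq[OF that(2)] s'_def by (rule absC_lform_sub[OF J])
        finally show ?thesis
          unfolding eq by (rule absC_add_eq_left)
      qed (simp add: eq)
    qed
    then have "A + \<tau> *s B \<in> band (N 0)"
      using pt_band[of s'] by (simp add: band_def)
    then show ?thesis
      using * by blast
  qed
  have log_p: "log q (absC (poly p (\<theta> ^ x))) =
      log_at F s' + k * (\<Sum>i<m. weighted s' (\<lambda>j. log q (N j (c i))))"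
    if xz: "x + z = s a + s b" and s': "s' = s(a := x, b := z)" for x z s'
  proof -
    have pt': "A + \<theta> ^ x *s B = pt s'"
      unfolding s' by (rule pt_eq[OF xz, symmetric])
    have "A + \<theta> ^ x *s B \<in> band (N 0)"
      unfolding pt' by (rule pt_band)
    with * have "absC (F (proj_pt (A + \<theta> ^ x *s B))) * (\<Prod>i<m. absC (lform (c i) (A + \<theta> ^ x *s B))) ^ k =
        absC (poly p (\<theta> ^ x))"
      by blast
    note eq = this[unfolded pt', symmetric]
    have F_pos: "absC (F (proj_pt (pt s'))) > 0"
      using FG pt_Omega[of s'] by force
    have c_pos: "absC (lform (c i) (pt s')) > 0" if "i < m" for i
      using * pt_nonzero[of "c i" s'] that by auto
    then have prod_pos: "(\<Prod>i<m. absC (lform (c i) (pt s'))) > 0"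
      by (intro prod_pos) auto
    have sum_s': "(\<Sum>i\<le>n. s' i) = D"
      unfolding s' using sum_shift[OF ab xz] s by simp
    have "log q (\<Prod>i<m. absC (lform (c i) (pt s'))) = (\<Sum>i<m. log q (absC (lform (c i) (pt s'))))"
      unfolding log_def sum_divide_distrib[symmetric] using c_pos by (subst ln_prod) auto
    also have "\<dots> = (\<Sum>i<m. weighted s' (\<lambda>j. log q (N j (c i))))"
      using * by (intro sum.cong log_absC_lform_pt[OF sum_s']) auto
    finally show ?thesis
      unfolding eq log_mult_pos[OF F_pos zero_less_power[OF prod_pos]] log_nat_power[OF less_imp_le[OF prod_pos]] log_at_def
      by simp
  qed
  define \<tau> where "\<tau> = (\<lambda>x :: nat. \<theta> ^ x)"
  have log_\<tau>: "log q (absC (\<tau> x)) = - (x / D)" for x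
    by (simp add: \<tau>_def absC_power absC_\<theta>_power)
  have "(real (s b) + real (s a)) * log q (absC (poly p (\<tau> (s a)))) \<le>
      s b * log q (absC (poly p (\<tau> 0))) + s a * log q (absC (poly p (\<tau> (s a + s b))))"
  proof (rule log_absC_poly_convex)
    show "\<delta> > 0"
      using * by blast
    show "\<delta> \<le> absC (poly p x)" if "\<tau>' \<in> {\<tau> 0, \<tau> (s a), \<tau> (s a + s b)}" "absC (x - \<tau>') < absC \<tau>'" for \<tau>' x
    proof -
      have "\<tau>' \<in> \<tau> ` {..s a + s b}"
        using that(1) by auto
      then obtain x' where x': "\<tau>' = \<theta> ^ x'" "x' \<le> s a + s b"
        by (auto simp: \<tau>_def)
      then show ?thesis
        using p_lower[of x x' "s a + s b - x'"] that(2) by simp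
    qed
    show "(real (s b) + real (s a)) * log q (absC (\<tau> (s a))) =
        real (s b) * log q (absC (\<tau> 0)) + real (s a) * log q (absC (\<tau> (s a + s b)))"
      unfolding log_\<tau> using D by (simp add: field_simps)
  qed (simp_all add: \<tau>_def \<theta>_nonzero)
  moreover have "log q (absC (poly p (\<tau> (s a)))) =
      log_at F s + k * (\<Sum>i<m. weighted s (\<lambda>j. log q (N j (c i))))"
    unfolding \<tau>_def by (rule log_p[of _ "s b"]) auto
  moreover have "log q (absC (poly p (\<tau> 0))) = log_at F (s(a := 0, b := s a + s b)) +
      k * (\<Sum>i<m. weighted (s(a := 0, b := s a + s b)) (\<lambda>j. log q (N j (c i))))"
    unfolding \<tau>_def by (rule log_p[of _ "s a + s b"]) auto
  moreover have "log q (absC (poly p (\<tau> (s a + s b)))) = log_at F (s(a := s a + s b, b := 0)) +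
      k * (\<Sum>i<m. weighted (s(a := s a + s b, b := 0)) (\<lambda>j. log q (N j (c i))))"
    unfolding \<tau>_def by (rule log_p[of _ 0]) auto
  moreover have "(real (s a) + real (s b)) * (\<Sum>i<m. weighted s (\<lambda>j. log q (N j (c i)))) =
      s b * (\<Sum>i<m. weighted (s(a := 0, b := s a + s b)) (\<lambda>j. log q (N j (c i)))) +
      s a * (\<Sum>i<m. weighted (s(a := s a + s b, b := 0)) (\<lambda>j. log q (N j (c i))))"
    unfolding sum_distrib_left sum.distrib[symmetric] using ab by (intro sum.cong weighted_shift) auto
  moreover have "u * h \<le> x * h1 + x' * h2"
    if "u * (h + k' * w) \<le> x * (h1 + k' * w1) + x' * (h2 + k' * w2)" "u * w = x * w1 + x' * w2"
    for u h k' w x h1 w1 x' h2 w2 :: real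
  proof -
    have "u * (h + k' * w) = u * h + k' * (u * w)"
      by (simp add: algebra_simps)
    then show ?thesis
      using that(1) unfolding that(2) by (simp add: algebra_simps)
  qed
  ultimately show ?thesis
    by (simp only: add.commute[of "real (s b)" "real (s a)"])
qed

end

definition vertex_weights :: "nat \<Rightarrow> nat \<Rightarrow> nat" where
  "vertex_weights i = (\<lambda>j. if j = i then D else 0)"

lemma sum_vertex_weights: "i \<le> n \<Longrightarrow> (\<Sum>j\<le>n. vertex_weights i j) = D"
  by (simp add: vertex_weights_def)

context
  fixes F G :: "('c^'r) set \<Rightarrow> 'c"
  assumes F: "rigid_holomorphic_on (Omega \<iota>) F" and G: "rigid_holomorphic_on (Omega \<iota>) G"
    and FG: "\<forall>P\<in>Omega \<iota>. F P * G P = 1"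
begin

text \<open>Convexity applies to \<open>F\<close> and to its inverse \<open>G\<close>.\<close>

lemma log_at_shift:
  assumes ab: "a < b" "b \<le> n" and s: "(\<Sum>i\<le>n. s i) = D"
  shows "(real (s a) + real (s b)) * log_at F s =
    s b * log_at F (s(a := 0, b := s a + s b)) + s a * log_at F (s(a := s a + s b, b := 0))"
proof (rule antisym)
  have GF: "\<forall>P\<in>Omega \<iota>. G P * F P = 1"
    using FG by (simp add: mult.commute)
  have neg: "log_at G s' = - log_at F s'" for s'
  proof -
    have "F (proj_pt (pt s')) * G (proj_pt (pt s')) = 1"
      using FG pt_Omega by blast
    then have "absC (F (proj_pt (pt s'))) * absC (G (proj_pt (pt s'))) = 1"
      by (metis absC_1 absC_mult)
    then have "absC (G (proj_pt (pt s'))) = inverse (absC (F (proj_pt (pt s'))))"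
      by (metis inverse_unique)
    then show ?thesis
      by (simp add: log_at_def log_def ln_inverse)
  qed
  show "s b * log_at F (s(a := 0, b := s a + s b)) + s a * log_at F (s(a := s a + s b, b := 0)) \<le>
      (real (s a) + real (s b)) * log_at F s"
    using log_at_convex[OF G F GF ab s] unfolding neg by simp
qed (rule log_at_convex[OF F G FG ab s])

lemma log_at_affine:
  assumes "(\<Sum>i\<le>n. s i) = D"
  shows "log_at F s = weighted s (\<lambda>i. log_at F (vertex_weights i))"
  using assms
proof (induction "card {i. i \<le> n \<and> s i \<noteq> 0}" arbitrary: s rule: less_induct)
  case less
  let ?g = "\<lambda>i. log_at F (vertex_weights i)"
  show ?case
  proof (cases "\<exists>a b. a < b \<and> b \<le> n \<and> s a \<noteq> 0 \<and> s b \<noteq> 0")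
    case True
    then obtain a b where ab: "a < b" "b \<le> n" "s a \<noteq> 0" "s b \<noteq> 0"
      by (elim exE conjE)
    define s1 where "s1 = s(a := 0, b := s a + s b)"
    define s2 where "s2 = s(a := s a + s b, b := 0)"
    have card_less: "card {i. i \<le> n \<and> s' i \<noteq> 0} < card {i. i \<le> n \<and> s i \<noteq> 0}"
      if "\<And>i. s i = 0 \<Longrightarrow> s' i = 0" "e \<le> n" "s e \<noteq> 0" "s' e = 0" for s' :: "nat \<Rightarrow> nat" and e
    proof (rule psubset_card_mono)
      show "{i. i \<le> n \<and> s' i \<noteq> 0} \<subset> {i. i \<le> n \<and> s i \<noteq> 0}"
      proof (rule psubsetI)
        show "{i. i \<le> n \<and> s' i \<noteq> 0} \<subseteq> {i. i \<le> n \<and> s i \<noteq> 0}"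
        proof
          fix i assume "i \<in> {i. i \<le> n \<and> s' i \<noteq> 0}"
          then have "i \<le> n" "s' i \<noteq> 0"
            by simp_all
          moreover from this have "s i \<noteq> 0"
            using that(1)[of i] by metis
          ultimately show "i \<in> {i. i \<le> n \<and> s i \<noteq> 0}"
            by simp
        qed
        have "e \<in> {i. i \<le> n \<and> s i \<noteq> 0}" "e \<notin> {i. i \<le> n \<and> s' i \<noteq> 0}"
          using that(2-4) by simp_all
        then show "{i. i \<le> n \<and> s' i \<noteq> 0} \<noteq> {i. i \<le> n \<and> s i \<noteq> 0}"
          by metis
      qed
    qed simp
    have "s1 i = 0" "s2 i = 0" if "s i = 0" for i
      using ab that by (auto simp: s1_def s2_def)
    then have "card {i. i \<le> n \<and> s1 i \<noteq> 0} < card {i. i \<le> n \<and> s i \<noteq> 0}"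
      "card {i. i \<le> n \<and> s2 i \<noteq> 0} < card {i. i \<le> n \<and> s i \<noteq> 0}"
      using ab card_less[of s1 a] card_less[of s2 b] by (simp_all add: s1_def s2_def)
    moreover have "(\<Sum>i\<le>n. s1 i) = D" "(\<Sum>i\<le>n. s2 i) = D"
      using sum_shift[OF ab(1,2)] less.prems by (simp_all add: s1_def s2_def)
    ultimately have "log_at F s1 = weighted s1 ?g" "log_at F s2 = weighted s2 ?g"
      using less.hyps by blast+
    then have "(real (s a) + real (s b)) * log_at F s = (real (s a) + real (s b)) * weighted s ?g"
      using log_at_shift[OF ab(1,2) less.prems] weighted_shift[of a b s ?g] ab(1)
      unfolding s1_def s2_def by simp
    moreover have "real (s a) + real (s b) \<noteq> 0"
      using ab(3) by simp
    ultimately show "log_at F s = weighted s ?g"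
      by (metis mult_left_cancel)
  next
    case False
    obtain i where i: "i \<le> n" "s i \<noteq> 0"
      using less.prems D by (metis atMost_iff less_irrefl sum.neutral)
    have s_0: "s j = 0" if "j \<le> n" "j \<noteq> i" for j
      using False i that by (metis linorder_neqE_nat)
    have "(\<Sum>j\<le>n. s j) = (\<Sum>j\<in>{i}. s j)"
      using i s_0 by (intro sum.mono_neutral_right) auto
    then have s_i: "s i = D"
      using less.prems by simp
    have "partial_sum s j = partial_sum (vertex_weights i) j" if "j \<le> n" for j
      unfolding partial_sum_def using s_0 s_i that by (intro sum.cong) (auto simp: vertex_weights_def)
    then have "pt s = pt (vertex_weights i)"
      unfolding pt_def by (intro sum.cong) auto
    then have "log_at F s = ?g i"
      by (simp add: log_at_def)
    also have "weighted s ?g = (\<Sum>j\<in>{i}. s j / D * ?g j)"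
      unfolding weighted_def using i s_0 by (intro sum.mono_neutral_right) auto
    then have "?g i = weighted s ?g"
      using s_i D by simp
    finally show "log_at F s = weighted s ?g" .
  qed
qed

lemma log_on_building_prod_norms:
  assumes "(\<Sum>i\<le>n. s i) = D"
  shows "log_on_building \<iota> F (homothety_class (\<lambda>v. \<Prod>i\<le>n. N i v powr (s i / D))) = log_at F s"
proof -
  obtain \<kappa> where \<kappa>: "\<kappa> > 0" "\<And>v j. \<kappa> * absK (v $ j) \<le> N 0 v"
    using ex_lower_bound by blast
  show ?thesis
    using log_on_building_eq[OF F G FG \<kappa> pt_band pt_Omega, of s]
    unfolding absC_lform_pt[OF assms] log_at_def .
qed

lemma log_on_building_vertex:
  assumes "i \<le> n"
  shows "log_on_building \<iota> F (vertex_of (L i)) = log_at F (vertex_weights i)"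
proof -
  have "(\<Prod>j\<le>n. N j v powr (vertex_weights i j / D)) = N i v" for v
  proof (cases "v = 0")
    case True
    then have "N i v = 0" "N 0 v = 0"
      using lattice[of 0] lattice[OF assms] by simp_all
    then show ?thesis
      by (auto intro!: prod_zero)
  next
    case False
    have "(\<Prod>j\<le>n. N j v powr (vertex_weights i j / D)) = (\<Prod>j\<le>n. if j = i then N j v else 1)"
    proof (rule prod.cong[OF refl])
      fix j assume "j \<in> {..n}"
      then have "N j v > 0"
        using False by (intro N_pos) auto
      then show "N j v powr (vertex_weights i j / D) = (if j = i then N j v else 1)"
        using D by (auto simp: vertex_weights_def)
    qed
    then show ?thesis
      using assms by simp
  qed
  then show ?thesis
    using log_on_building_prod_norms[OF sum_vertex_weights[OF assms]] by (simp add: vertex_of_def)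
qed

end

end

lemma ex_common_denominator:
  fixes t :: "'i \<Rightarrow> rat"
  assumes "finite I" "\<And>i. i \<in> I \<Longrightarrow> t i \<ge> 0"
  shows "\<exists>D>0. \<exists>s. \<forall>i\<in>I. t i = of_nat (s i) / of_nat D"
  using assms
proof (induction I rule: finite_induct)
  case empty
  show ?case
    by (intro exI[of _ 1]) simp
next
  case (insert x I)
  then obtain D s where D: "D > 0" "\<And>i. i \<in> I \<Longrightarrow> t i = of_nat (s i) / of_nat D"
    by auto
  obtain a b where ab: "quotient_of (t x) = (a, b)"
    by fastforce
  have b: "b > 0" "t x = of_int a / of_int b"
    using quotient_of_denom_pos[OF ab] quotient_of_div[OF ab] by simp_all
  then have "a \<ge> 0"
    using insert.prems[of x] by (simp add: zero_le_divide_iff)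
  with b have tx: "t x = of_nat (nat a) / of_nat (nat b)" and nb: "nat b > 0"
    by simp_all
  define s' where "s' = (\<lambda>i. if i = x then nat a * D else s i * nat b)"
  have "t i = of_nat (s' i) / of_nat (D * nat b)" if "i \<in> insert x I" for i
    using that D tx nb insert.hyps by (auto simp: s'_def)
  then show ?case
    using D(1) nb by (intro exI[of _ "D * nat b"]) auto
qed

lemma bt_point_eq:
  fixes N :: "nat \<Rightarrow> 'v \<Rightarrow> real"
  assumes "\<And>i v. i \<le> n \<Longrightarrow> N i v \<ge> 0" "(\<Sum>i\<le>n. t i) = 1"
  shows "bt_point n t (\<lambda>i. homothety_class (N i)) = homothety_class (\<lambda>v. \<Prod>i\<le>n. N i v powr of_rat (t i))"
proof
  show "bt_point n t (\<lambda>i. homothety_class (N i)) \<subseteq> homothety_class (\<lambda>v. \<Prod>i\<le>n. N i v powr of_rat (t i))"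
  proof
    fix P assume "P \<in> bt_point n t (\<lambda>i. homothety_class (N i))"
    then obtain M where M: "\<forall>i\<le>n. M i \<in> homothety_class (N i)" "P = (\<lambda>v. \<Prod>i\<le>n. M i v powr of_rat (t i))"
      unfolding bt_point_def by blast
    then have "\<forall>i. \<exists>r. i \<le> n \<longrightarrow> r > 0 \<and> M i = (\<lambda>v. r * N i v)"
      unfolding homothety_class_def by blast
    then obtain r where r: "\<And>i. i \<le> n \<Longrightarrow> r i > 0" "\<And>i. i \<le> n \<Longrightarrow> M i = (\<lambda>v. r i * N i v)"
      by metis
    have "P v = (\<Prod>i\<le>n. r i powr of_rat (t i)) * (\<Prod>i\<le>n. N i v powr of_rat (t i))" for v
      unfolding M(2) prod.distrib[symmetric] using r assms(1)
      by (intro prod.cong) (auto simp: powr_mult less_imp_le)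
    moreover have "(\<Prod>i\<le>n. r i powr of_rat (t i)) > 0"
      using r(1) by (intro prod_pos) force
    ultimately show "P \<in> homothety_class (\<lambda>v. \<Prod>i\<le>n. N i v powr of_rat (t i))"
      unfolding homothety_class_def by blast
  qed
  show "homothety_class (\<lambda>v. \<Prod>i\<le>n. N i v powr of_rat (t i)) \<subseteq> bt_point n t (\<lambda>i. homothety_class (N i))"
  proof
    fix P assume "P \<in> homothety_class (\<lambda>v. \<Prod>i\<le>n. N i v powr of_rat (t i))"
    then obtain c where c: "c > 0" "P = (\<lambda>v. c * (\<Prod>i\<le>n. N i v powr of_rat (t i)))"
      unfolding homothety_class_def by blast
    have "(\<Sum>i\<le>n. real_of_rat (t i)) = 1"
      using assms(2) by (metis of_rat_1 of_rat_sum)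
    then have "(\<Prod>i\<le>n. c powr of_rat (t i)) = c"
      using c(1) by (simp flip: powr_sum)
    then have "P = (\<lambda>v. \<Prod>i\<le>n. (c * N i v) powr of_rat (t i))"
      using c assms(1) by (simp add: powr_mult prod.distrib)
    then show "P \<in> bt_point n t (\<lambda>i. homothety_class (N i))"
      unfolding bt_point_def homothety_class_def using c(1) by (intro CollectI exI[of _ "\<lambda>i v. c * N i v"]) auto
  qed
qed

theorem theorem2p6:
  fixes \<iota> :: "'k::{field,finite} fls alg_closure \<Rightarrow> 'c::{field,complete_space}"
    and f :: "('c^'r::finite) set \<Rightarrow> 'c"
    and \<sigma> :: "('k fls^'r \<Rightarrow> real) set set"
    and k :: "nat \<Rightarrow> ('k fls^'r \<Rightarrow> real) set"
    and n :: nat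
    and t :: "nat \<Rightarrow> rat"
  assumes "C_infinity \<iota>"
    and "CARD('r) \<ge> 2"
    and "invertible_holomorphic_on (Omega \<iota> :: ('c^'r) set set) f"
    and "bt_simplex \<sigma>"
    and "bij_betw k {..n} \<sigma>"
    and "\<And>i. i \<le> n \<Longrightarrow> t i \<ge> 0"
    and "(\<Sum>i\<le>n. t i) = 1"
  shows "log_on_building \<iota> f (bt_point n t k) = (\<Sum>i\<le>n. of_rat (t i) * log_on_building \<iota> f (k i))"
proof -
  interpret C_infinity \<iota>
    by fact
  obtain g where f: "rigid_holomorphic_on (Omega \<iota>) f" and g: "rigid_holomorphic_on (Omega \<iota>) g"
    and fg: "\<forall>P\<in>Omega \<iota>. f P * g P = 1"
    using assms(3) unfolding invertible_holomorphic_on_def by blast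
  obtain n' L where L: "\<forall>i\<le>n'. is_lattice (L i)" "\<forall>i<n'. L (Suc i) \<subset> L i" "(*s) fls_X ` L 0 \<subset> L n'"
    and \<sigma>: "\<sigma> = (\<lambda>i. vertex_of (L i)) ` {..n'::nat}"
    using assms(4) unfolding bt_simplex_def by blast
  obtain D s where D: "D > 0" and s: "\<And>i. i \<le> n \<Longrightarrow> t i = of_nat (s i) / of_nat D"
    using ex_common_denominator[of "{..n}" t] assms(6) by auto
  obtain \<theta> y where \<theta>: "\<theta> ^ D = emb fls_X" and y: "\<forall>J\<subseteq>{..n'}. \<forall>d v. J \<noteq> {} \<longrightarrow>
      (\<forall>i\<in>J. absC \<theta> ^ d i * lattice_norm (L i) v \<le> absC (lform v (\<Sum>i\<in>J. \<theta> ^ d i *s y i))) \<and>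
      (\<exists>i\<in>J. absC (lform v (\<Sum>i\<in>J. \<theta> ^ d i *s y i)) = absC \<theta> ^ d i * lattice_norm (L i) v)"
    using ex_orthogonal_points[of n' L D] L(1) D by blast
  interpret lattice_chain_points \<iota> L n' D \<theta> y
  proof
    show "absC \<theta> ^ d i * lattice_norm (L i) v \<le> absC (lform v (\<Sum>i\<in>J. \<theta> ^ d i *s y i))"
      if "J \<subseteq> {..n'}" "i \<in> J" for J i d v
      using y that by blast
    show "\<exists>i\<in>J. absC (lform v (\<Sum>i\<in>J. \<theta> ^ d i *s y i)) = absC \<theta> ^ d i * lattice_norm (L i) v"
      if "J \<subseteq> {..n'}" "J \<noteq> {}" for J d v
      using y that by blast
  qed (use L D \<theta> in auto)
  have "\<forall>i. \<exists>j. i \<le> n \<longrightarrow> j \<le> n' \<and> k i = vertex_of (L j)"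
    using bij_betwE[OF assms(5)] unfolding \<sigma> by blast
  then obtain \<pi> where \<pi>: "\<And>i. i \<le> n \<Longrightarrow> \<pi> i \<le> n'" "\<And>i. i \<le> n \<Longrightarrow> k i = vertex_of (L (\<pi> i))"
    by metis
  define s' where "s' = (\<lambda>j. \<Sum>i\<in>{i \<in> {..n}. \<pi> i = j}. s i)"
  have t_real: "real_of_rat (t i) = s i / D" if "i \<le> n" for i
    using s[OF that] by (simp add: of_rat_divide)
  have "(\<Sum>i\<le>n. real_of_rat (t i)) = 1"
    using assms(7) by (metis of_rat_1 of_rat_sum)
  then have "(\<Sum>i\<le>n. s i / D) = 1"
    using t_real by simp
  then have "real (\<Sum>i\<le>n. s i) = real D"
    using D by (simp flip: sum_divide_distrib)
  then have sum_s: "(\<Sum>i\<le>n. s i) = D"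
    by (simp only: of_nat_eq_iff)
  have sum_s': "(\<Sum>j\<le>n'. s' j) = D"
    unfolding s'_def sum_s[symmetric] using \<pi>(1) by (intro sum.group) auto
  have norms: "(\<Prod>i\<le>n. N (\<pi> i) v powr of_rat (t i)) = (\<Prod>j\<le>n'. N j v powr (s' j / D))" for v
  proof (cases "v = 0")
    case True
    then have "N j v = 0" if "j \<le> n'" for j
      using lattice[OF that] by simp
    then show ?thesis
      using \<pi>(1)[of 0] by (intro trans[OF prod_zero prod_zero[symmetric]]) auto
  next
    case False
    have "(\<Prod>j\<le>n'. N j v powr (s' j / D)) = (\<Prod>j\<le>n'. \<Prod>i\<in>{i \<in> {..n}. \<pi> i = j}. N (\<pi> i) v powr (s i / D))"
    proof (rule prod.cong[OF refl])
      fix j assume "j \<in> {..n'}"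
      then have "N j v \<noteq> 0"
        using N_pos[OF _ False, of j] by simp
      then have "N j v powr (s' j / D) = (\<Prod>i\<in>{i \<in> {..n}. \<pi> i = j}. N j v powr (s i / D))"
        unfolding s'_def of_nat_sum sum_divide_distrib by (intro powr_sum) auto
      then show "N j v powr (s' j / D) = (\<Prod>i\<in>{i \<in> {..n}. \<pi> i = j}. N (\<pi> i) v powr (s i / D))"
        by simp
    qed
    also have "\<dots> = (\<Prod>i\<le>n. N (\<pi> i) v powr (s i / D))"
      using \<pi>(1) by (intro prod.group) auto
    finally show ?thesis
      using t_real by simp
  qed
  have "bt_point n t k = bt_point n t (\<lambda>i. homothety_class (N (\<pi> i)))"
    unfolding bt_point_def using \<pi>(2) by (simp add: vertex_of_def)
  also have "\<dots> = homothety_class (\<lambda>v. \<Prod>j\<le>n'. N j v powr (s' j / D))"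
    unfolding norms[symmetric] using assms(7) lattice_norm_nonneg[OF lattice[OF \<pi>(1)]]
    by (intro bt_point_eq)
  finally have "log_on_building \<iota> f (bt_point n t k) = log_at f s'"
    using log_on_building_prod_norms[OF f g fg sum_s'] by simp
  also have "\<dots> = (\<Sum>j\<le>n'. s' j / D * log_at f (vertex_weights j))"
    unfolding log_at_affine[OF f g fg sum_s'] weighted_def ..
  also have "\<dots> = (\<Sum>j\<le>n'. \<Sum>i\<in>{i \<in> {..n}. \<pi> i = j}. s i / D * log_at f (vertex_weights (\<pi> i)))"
    unfolding s'_def of_nat_sum sum_divide_distrib sum_distrib_right by (intro sum.cong) auto
  also have "\<dots> = (\<Sum>i\<le>n. s i / D * log_at f (vertex_weights (\<pi> i)))"
    using \<pi>(1) by (intro sum.group) auto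
  also have "\<dots> = (\<Sum>i\<le>n. of_rat (t i) * log_on_building \<iota> f (k i))"
    using \<pi> t_real log_on_building_vertex[OF f g fg] by (intro sum.cong) auto
  finally show ?thesis .
qed

end
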